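(* Let $m\ge1$ and let $H=\Delta+V$ be a Schrödinger operator on $\ell^2(\mathbb{Z}^m)$ with $V$ real-valued and bounded. Then for any $\psi\in\mathcal{H}_{\mathrm{pp}}(H)\cap D(\vec{Q})$, $$\lim_{T\to\infty}\frac1T\vec{Q}_H(T)\psi=0.$$
   Context: $\Delta$ is the nearest-neighbour Laplacian on $\mathbb{Z}^m$, $(\Delta\psi)(n)=\sum_{j=1}^m\big(\psi(n+e_j)+\psi(n-e_j)\big)$, with $e_j$ the standard basis vectors, and $V$ acts by multiplication. $\mathcal{H}_{\mathrm{pp}}(H)$ is the pure point subspace of $H$, i.e. the closed span of the $\ell^2$-eigenvectors of $H$ (it is not assumed that $H$ has only pure point spectrum). $\vec{Q}=(Q_1,\dots,Q_m)$ is the position operator, $(Q_j\psi)(n)=n_j\psi(n)$ with maximal domain $D(Q_j)$, $D(\vec{Q})=\bigcap_jD(Q_j)$, and $\vec{Q}_H(T)=e^{iTH}\vec{Q}e^{-iTH}$. The limit is in norm, componentwise. *)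

theory Defs
  imports "HOL-Analysis.Analysis"
begin


definition square_summable :: "('a \<Rightarrow> complex) \<Rightarrow> bool" where
  "square_summable f \<longleftrightarrow> (\<lambda>n. (cmod (f n))\<^sup>2) summable_on UNIV"

lemma square_summable_0: "square_summable (\<lambda>_. 0)"
  by (simp add: square_summable_def)

lemma square_summable_bounded_mult:
  assumes "square_summable f" and "\<And>n. cmod (g n) \<le> c * cmod (f n)"
  shows "square_summable g"
proof -
  have "(\<lambda>n. c\<^sup>2 * (cmod (f n))\<^sup>2) summable_on UNIV"
    using assms(1) by (auto simp: square_summable_def intro: summable_on_cmult_right)
  moreover have "(cmod (g n))\<^sup>2 \<le> c\<^sup>2 * (cmod (f n))\<^sup>2" for n
    using power_mono[OF assms(2)[of n], of 2] by (simp add: power_mult_distrib)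
  ultimately show ?thesis
    unfolding square_summable_def by (rule summable_on_comparison_test) auto
qed

lemma square_summable_scale: "square_summable f \<Longrightarrow> square_summable (\<lambda>n. c * f n)"
  by (erule square_summable_bounded_mult[where c = "cmod c"]) (simp add: norm_mult)

lemma square_summable_add:
  assumes "square_summable f" "square_summable g"
  shows "square_summable (\<lambda>n. f n + g n)"
proof -
  have "(\<lambda>n. 2 * (cmod (f n))\<^sup>2 + 2 * (cmod (g n))\<^sup>2) summable_on UNIV"
    using assms by (auto simp: square_summable_def intro!: summable_on_add summable_on_cmult_right)
  moreover have "(cmod (f n + g n))\<^sup>2 \<le> 2 * (cmod (f n))\<^sup>2 + 2 * (cmod (g n))\<^sup>2" for n
  proof -
    have "(cmod (f n + g n))\<^sup>2 \<le> (cmod (f n) + cmod (g n))\<^sup>2"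
      by (intro power_mono norm_triangle_ineq) auto
    also have "\<dots> \<le> 2 * (cmod (f n))\<^sup>2 + 2 * (cmod (g n))\<^sup>2"
      using sum_squares_ge_zero[of "cmod (f n) - cmod (g n)" 0]
      by (simp add: power2_eq_square algebra_simps)
    finally show ?thesis .
  qed
  ultimately show ?thesis
    unfolding square_summable_def by (rule summable_on_comparison_test) auto
qed

lemma square_summable_uminus: "square_summable f \<Longrightarrow> square_summable (\<lambda>n. - f n)"
  by (simp add: square_summable_def)

lemma square_summable_diff:
  "square_summable f \<Longrightarrow> square_summable g \<Longrightarrow> square_summable (\<lambda>n. f n - g n)"
  using square_summable_add[of f "\<lambda>n. - g n"] by (simp add: square_summable_uminus)

lemma square_summable_sum:
  "(\<And>i. i \<in> I \<Longrightarrow> square_summable (f i)) \<Longrightarrow> square_summable (\<lambda>n. \<Sum>i\<in>I. f i n)"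
  by (induction I rule: infinite_finite_induct)
     (auto simp: square_summable_0 intro: square_summable_add)

lemma square_summable_shift:
  fixes f :: "'a::ab_group_add \<Rightarrow> complex"
  assumes "square_summable f"
  shows "square_summable (\<lambda>n. f (n + v))"
proof -
  have "bij_betw (\<lambda>n. n + v) UNIV UNIV"
    by (rule bij_betw_byWitness[where f' = "\<lambda>n. n - v"]) auto
  from summable_on_reindex_bij_betw[OF this, of "\<lambda>n. (cmod (f n))\<^sup>2"] show ?thesis
    using assms by (simp add: square_summable_def)
qed

lemma square_summable_inner:
  assumes "square_summable f" "square_summable g"
  shows "(\<lambda>n. inner (f n) (g n)) summable_on UNIV"
proof -
  have s: "(\<lambda>n. (cmod (f n))\<^sup>2 + (cmod (g n))\<^sup>2) summable_on UNIV"
    using assms by (auto simp: square_summable_def intro!: summable_on_add)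
  have "norm (inner (f n) (g n)) \<le> (cmod (f n))\<^sup>2 + (cmod (g n))\<^sup>2" for n
  proof -
    have "norm (inner (f n) (g n)) \<le> cmod (f n) * cmod (g n)"
      using Cauchy_Schwarz_ineq2 by simp
    also have "\<dots> \<le> (cmod (f n))\<^sup>2 + (cmod (g n))\<^sup>2"
      using sum_squares_ge_zero[of "cmod (f n) - cmod (g n)" 0]
            mult_nonneg_nonneg[OF norm_ge_zero[of "f n"] norm_ge_zero[of "g n"]]
      unfolding power2_eq_square by (simp only: algebra_simps)
    finally show ?thesis .
  qed
  then have "(\<lambda>n. norm (inner (f n) (g n))) summable_on UNIV"
    by (intro summable_on_comparison_test[OF s]) auto
  then show ?thesis
    by (rule abs_summable_summable)
qed

typedef 'a ell2 = "{f :: 'a \<Rightarrow> complex. square_summable f}"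
  morphisms apply_ell2 Abs_ell2
  by (rule exI[of _ "\<lambda>_. 0"]) (simp add: square_summable_0)

setup_lifting type_definition_ell2

lemma square_summable_apply_ell2: "square_summable (apply_ell2 \<psi>)"
  using apply_ell2[of \<psi>] by simp

lemma ell2_eqI: "(\<And>n. apply_ell2 \<phi> n = apply_ell2 \<psi> n) \<Longrightarrow> \<phi> = \<psi>"
  by (simp add: apply_ell2_inject[symmetric] fun_eq_iff)

text \<open>The library has no class of complex inner product spaces; the instance below is the
  underlying real Hilbert space, with \<open>inner\<close> the real part of the usual sesquilinear form
  (hence with the usual norm, see \<open>norm_ell2\<close>).\<close>

instantiation ell2 :: (type) real_inner
begin

lift_definition zero_ell2 :: "'a ell2" is "\<lambda>_. 0"
  by (rule square_summable_0)

lift_definition plus_ell2 :: "'a ell2 \<Rightarrow> 'a ell2 \<Rightarrow> 'a ell2" is "\<lambda>f g n. f n + g n"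
  by (rule square_summable_add)

lift_definition minus_ell2 :: "'a ell2 \<Rightarrow> 'a ell2 \<Rightarrow> 'a ell2" is "\<lambda>f g n. f n - g n"
  by (rule square_summable_diff)

lift_definition uminus_ell2 :: "'a ell2 \<Rightarrow> 'a ell2" is "\<lambda>f n. - f n"
  by (rule square_summable_uminus)

lift_definition scaleR_ell2 :: "real \<Rightarrow> 'a ell2 \<Rightarrow> 'a ell2" is "\<lambda>r f n. r *\<^sub>R f n"
  by (simp add: scaleR_conv_of_real square_summable_scale)

definition inner_ell2 :: "'a ell2 \<Rightarrow> 'a ell2 \<Rightarrow> real" where
  "inner_ell2 \<phi> \<psi> = (\<Sum>\<^sub>\<infinity>n. inner (apply_ell2 \<phi> n) (apply_ell2 \<psi> n))"

definition norm_ell2 :: "'a ell2 \<Rightarrow> real" where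
  "norm_ell2 \<psi> = sqrt (inner \<psi> \<psi>)"

definition dist_ell2 :: "'a ell2 \<Rightarrow> 'a ell2 \<Rightarrow> real" where
  "dist_ell2 \<phi> \<psi> = norm (\<phi> - \<psi>)"

definition sgn_ell2 :: "'a ell2 \<Rightarrow> 'a ell2" where
  "sgn_ell2 \<psi> = inverse (norm \<psi>) *\<^sub>R \<psi>"

definition uniformity_ell2 :: "('a ell2 \<times> 'a ell2) filter" where
  "uniformity_ell2 = (INF e\<in>{0<..}. principal {(x, y). dist x y < e})"

definition open_ell2 :: "'a ell2 set \<Rightarrow> bool" where
  "open_ell2 U \<longleftrightarrow> (\<forall>x\<in>U. eventually (\<lambda>(x', y). x' = x \<longrightarrow> y \<in> U) uniformity)"

instance
proof
  fix a b c :: "'a ell2" and r s :: real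
  show "a + b + c = a + (b + c)" by transfer (simp add: add.assoc)
  show "a + b = b + a" by transfer (simp add: add.commute)
  show "0 + a = a" by transfer simp
  show "- a + a = 0" by transfer simp
  show "a - b = a + - b" by transfer simp
  show "r *\<^sub>R (a + b) = r *\<^sub>R a + r *\<^sub>R b" by transfer (simp add: scaleR_add_right)
  show "(r + s) *\<^sub>R a = r *\<^sub>R a + s *\<^sub>R a" by transfer (simp add: scaleR_add_left)
  show "r *\<^sub>R s *\<^sub>R a = (r * s) *\<^sub>R a" by transfer simp
  show "1 *\<^sub>R a = a" by transfer simp
  show "sgn a = inverse (norm a) *\<^sub>R a" by (rule sgn_ell2_def)
  show "dist a b = norm (a - b)" by (rule dist_ell2_def)
  show "(uniformity :: ('a ell2 \<times> 'a ell2) filter) =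
      (INF e\<in>{0<..}. principal {(x, y). dist x y < e})" by (rule uniformity_ell2_def)
  show "open U = (\<forall>x\<in>U. \<forall>\<^sub>F (x', y) in uniformity. x' = x \<longrightarrow> y \<in> U)" for U :: "'a ell2 set"
    by (rule open_ell2_def)
  note sm = square_summable_inner[OF square_summable_apply_ell2 square_summable_apply_ell2]
  show "inner a b = inner b a" by (simp add: inner_ell2_def inner_commute)
  show "inner (a + b) c = inner a c + inner b c"
    by (simp add: inner_ell2_def plus_ell2.rep_eq inner_add_left infsum_add sm)
  show "inner (r *\<^sub>R a) b = r * inner a b"
    by (simp add: inner_ell2_def scaleR_ell2.rep_eq infsum_cmult_right')
  show "0 \<le> inner a a" by (simp add: inner_ell2_def infsum_nonneg)
  show "inner a a = 0 \<longleftrightarrow> a = 0"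
  proof
    assume "inner a a = 0"
    then have "inner (apply_ell2 a n) (apply_ell2 a n) = 0" for n
      unfolding inner_ell2_def using sm[of a a]
      by (intro nonneg_infsum_le_0D[where A = UNIV and f = "\<lambda>n. inner (apply_ell2 a n) (apply_ell2 a n)"]) auto
    then show "a = 0" by (intro ell2_eqI) (simp add: zero_ell2.rep_eq)
  qed (simp add: inner_ell2_def zero_ell2.rep_eq)
  show "norm a = sqrt (inner a a)" by (rule norm_ell2_def)
qed

end

lemma norm_ell2: "norm \<psi> = sqrt (\<Sum>\<^sub>\<infinity>n. (cmod (apply_ell2 \<psi> n))\<^sup>2)"
  by (simp add: norm_ell2_def inner_ell2_def dot_square_norm)

lemma norm_ell2_leI:
  assumes "\<And>F. finite F \<Longrightarrow> (\<Sum>n\<in>F. (cmod (apply_ell2 \<psi> n))\<^sup>2) \<le> c\<^sup>2" "0 \<le> c"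
  shows "norm \<psi> \<le> c"
proof -
  have "(\<Sum>\<^sub>\<infinity>n. (cmod (apply_ell2 \<psi> n))\<^sup>2) \<le> c\<^sup>2"
    using square_summable_apply_ell2[of \<psi>] assms(1)
    by (intro infsum_le_finite_sums) (auto simp: square_summable_def)
  then show ?thesis
    unfolding norm_ell2 using assms(2) by (metis real_sqrt_le_mono real_sqrt_abs abs_of_nonneg)
qed

lemma sum_le_norm_ell2:
  assumes "finite F"
  shows "(\<Sum>n\<in>F. (cmod (apply_ell2 \<psi> n))\<^sup>2) \<le> (norm \<psi>)\<^sup>2"
proof -
  have "(\<Sum>n\<in>F. (cmod (apply_ell2 \<psi> n))\<^sup>2) \<le> (\<Sum>\<^sub>\<infinity>n. (cmod (apply_ell2 \<psi> n))\<^sup>2)"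
    using square_summable_apply_ell2[of \<psi>] assms
    by (intro finite_sum_le_infsum) (auto simp: square_summable_def)
  then show ?thesis
    by (simp add: norm_ell2 infsum_nonneg)
qed

lemma cmod_apply_ell2_le: "cmod (apply_ell2 \<psi> n) \<le> norm \<psi>"
  using sum_le_norm_ell2[of "{n}" \<psi>] by (simp add: power2_le_iff_abs_le)

instance ell2 :: (type) banach
proof
  fix X :: "nat \<Rightarrow> 'a ell2"
  assume X: "Cauchy X"
  have "Cauchy (\<lambda>k. apply_ell2 (X k) n)" for n
  proof (rule metric_CauchyI)
    fix e :: real assume "0 < e"
    then obtain M where M: "\<And>k l. k \<ge> M \<Longrightarrow> l \<ge> M \<Longrightarrow> dist (X k) (X l) < e"
      using X by (meson metric_CauchyD)
    have "dist (apply_ell2 (X k) n) (apply_ell2 (X l) n) \<le> dist (X k) (X l)" for k l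
      using cmod_apply_ell2_le[of "X k - X l" n] by (simp add: dist_norm minus_ell2.rep_eq)
    then show "\<exists>M. \<forall>k\<ge>M. \<forall>l\<ge>M. dist (apply_ell2 (X k) n) (apply_ell2 (X l) n) < e"
      using M by (meson le_less_trans)
  qed
  then have "\<exists>f. \<forall>n. (\<lambda>k. apply_ell2 (X k) n) \<longlonglongrightarrow> f n"
    by (intro choice) (auto simp: Cauchy_convergent_iff convergent_def)
  then obtain f where f: "\<And>n. (\<lambda>k. apply_ell2 (X k) n) \<longlonglongrightarrow> f n" by blast
  have fin: "(\<Sum>n\<in>F. (cmod (apply_ell2 (X k) n - f n))\<^sup>2) \<le> e\<^sup>2"
    if "finite F" and M: "\<And>k l. k \<ge> M \<Longrightarrow> l \<ge> M \<Longrightarrow> dist (X k) (X l) < e" and "k \<ge> M"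
    for F M k e
  proof (rule tendsto_upperbound)
    show "(\<lambda>l. \<Sum>n\<in>F. (cmod (apply_ell2 (X k) n - apply_ell2 (X l) n))\<^sup>2)
        \<longlonglongrightarrow> (\<Sum>n\<in>F. (cmod (apply_ell2 (X k) n - f n))\<^sup>2)"
      by (intro tendsto_intros f)
    have "(\<Sum>n\<in>F. (cmod (apply_ell2 (X k) n - apply_ell2 (X l) n))\<^sup>2) \<le> e\<^sup>2" if "l \<ge> M" for l
    proof -
      have "(\<Sum>n\<in>F. (cmod (apply_ell2 (X k) n - apply_ell2 (X l) n))\<^sup>2) \<le> (norm (X k - X l))\<^sup>2"
        using sum_le_norm_ell2[OF \<open>finite F\<close>, of "X k - X l"] by (simp add: minus_ell2.rep_eq)
      also have "\<dots> \<le> e\<^sup>2"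
        using M[OF \<open>k \<ge> M\<close> that] by (intro power_mono) (auto simp: dist_norm)
      finally show ?thesis .
    qed
    then show "\<forall>\<^sub>F l in sequentially. (\<Sum>n\<in>F. (cmod (apply_ell2 (X k) n - apply_ell2 (X l) n))\<^sup>2) \<le> e\<^sup>2"
      by (auto simp: eventually_sequentially)
  qed simp
  obtain M1 where M1: "\<And>k l. k \<ge> M1 \<Longrightarrow> l \<ge> M1 \<Longrightarrow> dist (X k) (X l) < 1"
    using X by (meson metric_CauchyD zero_less_one)
  have "square_summable (\<lambda>n. apply_ell2 (X M1) n - f n)"
    unfolding square_summable_def
    by (rule nonneg_bdd_above_summable_on) (auto intro!: bdd_aboveI[of _ 1] dest: fin[OF _ M1, of _ M1])
  from square_summable_diff[OF square_summable_apply_ell2[of "X M1"] this]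
  have "square_summable f" by simp
  then obtain \<phi> where \<phi>: "apply_ell2 \<phi> = f"
    using Abs_ell2_inverse by blast
  have "X \<longlonglongrightarrow> \<phi>"
  proof (rule metric_LIMSEQ_I)
    fix r :: real assume "0 < r"
    then have "0 < r / 2" by simp
    then obtain M where M: "\<And>k l. k \<ge> M \<Longrightarrow> l \<ge> M \<Longrightarrow> dist (X k) (X l) < r / 2"
      using X by (meson metric_CauchyD)
    have "norm (X k - \<phi>) \<le> r / 2" if "k \<ge> M" for k
      using fin[OF _ M that] \<open>0 < r\<close> by (intro norm_ell2_leI) (auto simp: minus_ell2.rep_eq \<phi>)
    then show "\<exists>no. \<forall>k\<ge>no. dist (X k) \<phi> < r"
      using \<open>0 < r\<close> by (intro exI[of _ M]) (force simp: dist_norm)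
  qed
  then show "convergent X" by (auto simp: convergent_def)
qed

lift_definition scaleC :: "complex \<Rightarrow> 'a ell2 \<Rightarrow> 'a ell2" (infixr \<open>*\<^sub>C\<close> 75)
  is "\<lambda>c f n. c * f n"
  by (rule square_summable_scale)

global_interpretation ell2: vector_space "scaleC :: complex \<Rightarrow> 'a ell2 \<Rightarrow> 'a ell2"
  by standard (transfer, simp add: fun_eq_iff algebra_simps)+

lemma norm_scaleC: "norm (c *\<^sub>C \<psi>) = cmod c * norm \<psi>"
  by (simp add: norm_ell2 scaleC.rep_eq norm_mult power_mult_distrib infsum_cmult_right'
      real_sqrt_mult)



lift_definition laplacian :: "(int ^ 'm) ell2 \<Rightarrow> (int ^ 'm) ell2"
  is "\<lambda>\<psi> n. \<Sum>j\<in>UNIV. \<psi> (n + axis j 1) + \<psi> (n - axis j 1)"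
  using square_summable_shift[of _ "- axis _ 1"]
  by (intro square_summable_sum square_summable_add) (auto intro: square_summable_shift)

text \<open>Multiplication by \<open>f\<close> with its maximal domain; the operator gets the value 0 outside.\<close>

definition mult_domain :: "('a \<Rightarrow> complex) \<Rightarrow> 'a ell2 set" where
  "mult_domain f = {\<psi>. square_summable (\<lambda>n. f n * apply_ell2 \<psi> n)}"

lift_definition mult_op :: "('a \<Rightarrow> complex) \<Rightarrow> 'a ell2 \<Rightarrow> 'a ell2"
  is "\<lambda>f \<psi>. if square_summable (\<lambda>n. f n * \<psi> n) then (\<lambda>n. f n * \<psi> n) else (\<lambda>_. 0)"
  by (auto simp: square_summable_0)

lemma apply_mult_op: "\<psi> \<in> mult_domain f \<Longrightarrow> apply_ell2 (mult_op f \<psi>) n = f n * apply_ell2 \<psi> n"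
  by (simp add: mult_domain_def mult_op.rep_eq)

lemma mult_domain_bounded:
  assumes "\<And>n. cmod (f n) \<le> c"
  shows "mult_domain f = UNIV"
proof -
  have "square_summable (\<lambda>n. f n * apply_ell2 \<psi> n)" for \<psi>
    by (rule square_summable_bounded_mult[OF square_summable_apply_ell2[of \<psi>], of _ c])
       (simp add: norm_mult assms mult_right_mono)
  then show ?thesis by (auto simp: mult_domain_def)
qed

definition schroedinger :: "(int ^ 'm \<Rightarrow> real) \<Rightarrow> (int ^ 'm) ell2 \<Rightarrow> (int ^ 'm) ell2" where
  "schroedinger V \<psi> = laplacian \<psi> + mult_op (\<lambda>n. complex_of_real (V n)) \<psi>"

definition position_domain :: "'m \<Rightarrow> (int ^ 'm) ell2 set" where
  "position_domain j = mult_domain (\<lambda>n. of_int (n $ j))"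

definition position :: "'m \<Rightarrow> (int ^ 'm) ell2 \<Rightarrow> (int ^ 'm) ell2" where
  "position j = mult_op (\<lambda>n. of_int (n $ j))"

definition eigenvector :: "('a ell2 \<Rightarrow> 'a ell2) \<Rightarrow> 'a ell2 \<Rightarrow> bool" where
  "eigenvector A \<psi> \<longleftrightarrow> \<psi> \<noteq> 0 \<and> (\<exists>E. A \<psi> = E *\<^sub>C \<psi>)"

definition pp_subspace :: "('a ell2 \<Rightarrow> 'a ell2) \<Rightarrow> 'a ell2 set" where
  "pp_subspace A = closure (ell2.span {\<psi>. eigenvector A \<psi>})"

text \<open>The exponential series, meaningful for bounded \<open>A\<close> (see \<open>summable_exp_op\<close>).\<close>

definition exp_op :: "('a ell2 \<Rightarrow> 'a ell2) \<Rightarrow> 'a ell2 \<Rightarrow> 'a ell2" where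
  "exp_op A \<psi> = (\<Sum>k. (A ^^ k) \<psi> /\<^sub>R fact k)"

definition heisenberg_domain :: "('a ell2 \<Rightarrow> 'a ell2) \<Rightarrow> real \<Rightarrow> 'a ell2 set \<Rightarrow> 'a ell2 set" where
  "heisenberg_domain H T D = {\<psi>. exp_op (\<lambda>\<phi>. (- \<i> * of_real T) *\<^sub>C H \<phi>) \<psi> \<in> D}"

definition heisenberg ::
  "('a ell2 \<Rightarrow> 'a ell2) \<Rightarrow> real \<Rightarrow> ('a ell2 \<Rightarrow> 'a ell2) \<Rightarrow> 'a ell2 \<Rightarrow> 'a ell2" where
  "heisenberg H T B \<psi> =
     exp_op (\<lambda>\<phi>. (\<i> * of_real T) *\<^sub>C H \<phi>) (B (exp_op (\<lambda>\<phi>. (- \<i> * of_real T) *\<^sub>C H \<phi>) \<psi>))"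

lemma summable_exp_op:
  fixes A :: "'a ell2 \<Rightarrow> 'a ell2"
  assumes "bounded_linear A"
  shows "summable (\<lambda>k. (A ^^ k) \<psi> /\<^sub>R fact k)"
proof -
  obtain K where K: "K \<ge> 0" "\<And>\<psi>. norm (A \<psi>) \<le> norm \<psi> * K"
    using bounded_linear.nonneg_bounded[OF assms] by blast
  have "norm ((A ^^ k) \<psi>) \<le> K ^ k * norm \<psi>" for k
  proof (induction k)
    case (Suc k)
    have "norm ((A ^^ Suc k) \<psi>) \<le> norm ((A ^^ k) \<psi>) * K"
      using K(2)[of "(A ^^ k) \<psi>"] by simp
    also have "\<dots> \<le> K ^ k * norm \<psi> * K"
      using Suc K(1) by (rule mult_right_mono)
    finally show ?case by (simp add: algebra_simps)
  qed simp
  then have "norm ((A ^^ k) \<psi> /\<^sub>R fact k) \<le> (K ^ k /\<^sub>R fact k) * norm \<psi>" for k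
    by (simp add: field_simps)
  moreover have "summable (\<lambda>k. (K ^ k /\<^sub>R fact k) * norm \<psi>)"
    by (intro summable_mult2 summable_exp_generic)
  ultimately show ?thesis
    by (rule summable_comparison_test'[rotated])
qed

lemma bounded_linear_scaleC: "bounded_linear A \<Longrightarrow> bounded_linear (\<lambda>\<psi>. c *\<^sub>C A \<psi>)"
proof (rule bounded_linear_compose[of "\<lambda>\<psi>. c *\<^sub>C \<psi>"])
  show "bounded_linear (\<lambda>\<psi> :: 'b ell2. c *\<^sub>C \<psi>)"
  proof (rule bounded_linear_intro)
    show "c *\<^sub>C (x + y) = c *\<^sub>C x + c *\<^sub>C y" for x y :: "'b ell2"
      by (rule ell2.scale_right_distrib)
    show "c *\<^sub>C (r *\<^sub>R x) = r *\<^sub>R c *\<^sub>C x" for r and x :: "'b ell2"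
      by transfer (simp add: fun_eq_iff)
    show "norm (c *\<^sub>C x) \<le> norm x * cmod c" for x :: "'b ell2"
      by (simp add: norm_scaleC)
  qed
qed

lemma bounded_linear_mult_op:
  assumes "\<And>n. cmod (f n) \<le> c"
  shows "bounded_linear (mult_op f)"
proof (rule bounded_linear_intro)
  have D: "\<psi> \<in> mult_domain f" for \<psi>
    using mult_domain_bounded[of f c] assms by auto
  show "mult_op f (x + y) = mult_op f x + mult_op f y" for x y
    by (rule ell2_eqI) (simp add: apply_mult_op[OF D] plus_ell2.rep_eq algebra_simps)
  show "mult_op f (r *\<^sub>R x) = r *\<^sub>R mult_op f x" for r x
    by (rule ell2_eqI) (simp add: apply_mult_op[OF D] scaleR_ell2.rep_eq)
  have c: "0 \<le> c" using assms norm_ge_zero order_trans by blast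
  show "norm (mult_op f x) \<le> norm x * c" for x
  proof (rule norm_ell2_leI)
    fix F :: "'a set" assume F: "finite F"
    have "(\<Sum>n\<in>F. (cmod (apply_ell2 (mult_op f x) n))\<^sup>2) \<le> (\<Sum>n\<in>F. c\<^sup>2 * (cmod (apply_ell2 x n))\<^sup>2)"
      using assms by (intro sum_mono) (simp add: apply_mult_op[OF D] norm_mult power_mult_distrib mult_right_mono power_mono)
    also have "\<dots> \<le> c\<^sup>2 * (norm x)\<^sup>2"
      using sum_le_norm_ell2[OF F] by (simp flip: sum_distrib_left add: mult_left_mono)
    finally show "(\<Sum>n\<in>F. (cmod (apply_ell2 (mult_op f x) n))\<^sup>2) \<le> (norm x * c)\<^sup>2"
      by (simp add: power_mult_distrib mult.commute)
  qed (use c in simp)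
qed

lemma bounded_linear_laplacian: "bounded_linear (laplacian :: (int ^ 'm) ell2 \<Rightarrow> _)"
proof -
  define S :: "int ^ 'm \<Rightarrow> (int ^ 'm) ell2 \<Rightarrow> (int ^ 'm) ell2"
    where "S v \<psi> = Abs_ell2 (\<lambda>n. apply_ell2 \<psi> (n + v))" for v \<psi>
  have S: "apply_ell2 (S v \<psi>) n = apply_ell2 \<psi> (n + v)" for v \<psi> n
    by (simp add: S_def Abs_ell2_inverse square_summable_shift square_summable_apply_ell2)
  have bl: "bounded_linear (S v)" for v
  proof (rule bounded_linear_intro)
    show "S v (x + y) = S v x + S v y" for x y
      by (rule ell2_eqI) (simp add: S plus_ell2.rep_eq)
    show "S v (r *\<^sub>R x) = r *\<^sub>R S v x" for r x
      by (rule ell2_eqI) (simp add: S scaleR_ell2.rep_eq)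
    have b: "bij_betw (\<lambda>n. n + v) UNIV UNIV"
      by (rule bij_betw_byWitness[where f' = "\<lambda>n. n - v"]) auto
    show "norm (S v x) \<le> norm x * 1" for x
      using infsum_reindex_bij_betw[OF b, of "\<lambda>n. (cmod (apply_ell2 x n))\<^sup>2"]
      by (simp add: norm_ell2 S)
  qed
  have sum: "apply_ell2 (\<Sum>j\<in>J. g j) n = (\<Sum>j\<in>J. apply_ell2 (g j) n)"
    for J :: "'m set" and g :: "'m \<Rightarrow> (int ^ 'm) ell2" and n
    by (induction J rule: infinite_finite_induct) (auto simp: zero_ell2.rep_eq plus_ell2.rep_eq)
  have "laplacian \<psi> = (\<Sum>j\<in>UNIV. S (axis j 1) \<psi> + S (- axis j 1) \<psi>)" for \<psi> :: "(int ^ 'm) ell2"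
    by (rule ell2_eqI) (simp add: laplacian.rep_eq sum S plus_ell2.rep_eq)
  then have "laplacian = (\<lambda>\<psi>. \<Sum>j\<in>UNIV. S (axis j 1) \<psi> + S (- axis j 1) \<psi>)"
    by (rule ext)
  moreover have "bounded_linear \<dots>"
    by (intro bounded_linear_sum bounded_linear_add bl)
  ultimately show ?thesis by metis
qed

lemma bounded_linear_schroedinger:
  assumes "bounded (range V)"
  shows "bounded_linear (schroedinger V)"
proof -
  obtain c where "\<And>n. norm (V n) \<le> c"
    using assms by (auto simp: bounded_iff)
  then have "bounded_linear (mult_op (\<lambda>n. complex_of_real (V n)))"
    by (intro bounded_linear_mult_op[where c = c]) simp
  then have "bounded_linear (\<lambda>\<psi>. laplacian \<psi> + mult_op (\<lambda>n. complex_of_real (V n)) \<psi>)"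
    by (rule bounded_linear_add[OF bounded_linear_laplacian])
  then show ?thesis
    by (simp add: schroedinger_def[abs_def])
qed

end

theory Submission
  imports Defs
begin

text \<open>Write \<open>U(T) = e\<^sup>-\<^sup>i\<^sup>T\<^sup>H\<close>, let \<open>M\<^sub>S\<close> be multiplication by \<open>n\<^sub>j\<close> truncated to \<open>[-S, S]\<close>,
  and let \<open>C\<^sub>S(T) = [M\<^sub>S, U(T)]\<close>. Since \<open>x(t) = C\<^sub>S(t)\<psi>\<close> solves
  \<open>x' = -iHx + i[H, M\<^sub>S]U(t)\<psi>\<close> with \<open>x(0) = 0\<close> and \<open>-iH\<close> is skew, an energy estimate bounds
  \<open>norm (C\<^sub>S(T)\<psi>)\<close> by \<open>T\<close> times the supremum of \<open>norm ([H, M\<^sub>S]U(t)\<psi>)\<close>, hence by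
  \<open>2 T norm \<psi>\<close>, uniformly in \<open>S\<close>. If \<open>\<phi>\<close> is an eigenvector, then \<open>U(t)\<phi>\<close> is a multiple of
  \<open>\<phi>\<close>; splitting \<open>M\<^sub>S = M\<^sub>R + (M\<^sub>S - M\<^sub>R)\<close> and bounding the first commutator trivially gives
  \<open>norm (C\<^sub>S(T)\<phi>) \<le> 2 R norm \<phi> + 2 T norm (1\<^sub>L \<phi>)\<close> with \<open>L = {\<bar>n\<^sub>j\<bar> \<ge> R}\<close>. So \<open>C\<^sub>S(T) / T\<close>
  tends to 0 uniformly in \<open>S\<close> on eigenvectors, and by the uniform bound on the whole pure point
  subspace. Finally \<open>norm (M\<^sub>S U(T)\<psi>) \<le> norm (Q\<^sub>j \<psi>) + norm (C\<^sub>S(T)\<psi>)\<close>, and \<open>S \<rightarrow> \<infinity>\<close>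
  gives both the domain statement and the limit; no virial theorem is needed.\<close>

subsection \<open>Operators on square-summable functions\<close>

lemma norm_ell2_mono:
  assumes "\<And>n. cmod (apply_ell2 x n) \<le> cmod (apply_ell2 y n)"
  shows "norm x \<le> norm y"
proof (rule norm_ell2_leI)
  fix F :: "'a set" assume "finite F"
  have "(\<Sum>n\<in>F. (cmod (apply_ell2 x n))\<^sup>2) \<le> (\<Sum>n\<in>F. (cmod (apply_ell2 y n))\<^sup>2)"
    using assms by (intro sum_mono power_mono) auto
  also have "\<dots> \<le> (norm y)\<^sup>2"
    using \<open>finite F\<close> by (rule sum_le_norm_ell2)
  finally show "(\<Sum>n\<in>F. (cmod (apply_ell2 x n))\<^sup>2) \<le> (norm y)\<^sup>2" .
qed simp

lemma scaleC_scaleR: "(c * of_real r) *\<^sub>C x = r *\<^sub>R (c *\<^sub>C x)"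
  by transfer (simp add: fun_eq_iff scaleR_conv_of_real)

text \<open>\<open>inner\<close> is the real part of a sesquilinear form, so the real adjoint of
  multiplication by \<open>c\<close> is multiplication by \<open>cnj c\<close>. Skewness of the
  generator rests on this.\<close>

lemma inner_scaleC_left: "inner (c *\<^sub>C x) y = inner x (cnj c *\<^sub>C y)"
  by (simp add: inner_ell2_def scaleC.rep_eq inner_complex_def algebra_simps)

lemma bounded_linear_scaleC_id: "bounded_linear (\<lambda>x. c *\<^sub>C x)"
  using bounded_linear_scaleC[OF bounded_linear_ident] .

lemma norm_mult_op_le:
  assumes "\<And>n. cmod (f n) \<le> c"
  shows "norm (mult_op f x) \<le> c * norm x"
proof -
  have "0 \<le> c" using assms norm_ge_zero order_trans by blast
  have "x \<in> mult_domain f" using mult_domain_bounded[of f c] assms by auto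
  then have "norm (mult_op f x) \<le> norm (complex_of_real c *\<^sub>C x)"
    using assms \<open>0 \<le> c\<close>
    by (intro norm_ell2_mono) (simp add: apply_mult_op scaleC.rep_eq norm_mult mult_right_mono)
  then show ?thesis using \<open>0 \<le> c\<close> by (simp add: norm_scaleC)
qed

section \<open>The exponential series of a bounded operator\<close>

lemma exp_op_additive:
  assumes "bounded_linear A"
  shows "exp_op A (x + y) = exp_op A x + exp_op A y"
proof -
  have "(A ^^ k) (x + y) = (A ^^ k) x + (A ^^ k) y" for k
    by (induction k) (simp_all add: linear_add[OF bounded_linear.linear[OF assms]])
  then show ?thesis
    unfolding exp_op_def
    by (simp add: scaleR_add_right suminf_add[OF summable_exp_op[OF assms] summable_exp_op[OF assms]])
qed

text \<open>\<open>L\<close> commutes with every power of \<open>A\<close> and passes through the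
  series by continuity. Taking multiplication by a complex scalar for \<open>L\<close> shows that
  the evolution is complex linear.\<close>

lemma exp_op_intertwine:
  assumes "bounded_linear A" "bounded_linear L" and "\<And>x. L (A x) = A (L x)"
  shows "L (exp_op A x) = exp_op A (L x)"
proof -
  have "L ((A ^^ k) x) = (A ^^ k) (L x)" for k
    by (induction k) (simp_all add: assms(3))
  then show ?thesis
    unfolding exp_op_def
    by (simp add: bounded_linear.suminf[OF assms(2) summable_exp_op[OF assms(1)]]
        linear_scale[OF bounded_linear.linear[OF assms(2)]])
qed

text \<open>Each power of \<open>A\<close> acts on \<open>x\<close> as the same power of
  \<open>c\<close>, so the series is the scalar exponential series applied to \<open>x\<close>.
  Since \<open>bounded_linear\<close> refers to real scalars, complex homogeneity of
  \<open>A\<close> is a separate assumption.\<close>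

lemma exp_op_eigenvector:
  assumes "bounded_linear A" and "A x = c *\<^sub>C x" and "\<And>a y. A (a *\<^sub>C y) = a *\<^sub>C A y"
  shows "exp_op A x = exp c *\<^sub>C x"
proof -
  have pow: "(A ^^ k) x = c ^ k *\<^sub>C x" for k
    by (induction k) (simp_all add: assms(2,3) mult.commute)
  have "bounded_linear (\<lambda>a. a *\<^sub>C x)"
  proof (rule bounded_linear_intro)
    show "(r *\<^sub>R a) *\<^sub>C x = r *\<^sub>R (a *\<^sub>C x)" for r a
      using scaleC_scaleR[of a r x] by (simp add: scaleR_conv_of_real mult.commute)
    show "norm (a *\<^sub>C x) \<le> norm a * norm x" for a
      by (simp add: norm_scaleC)
  qed (rule ell2.scale_left_distrib)
  then have "exp c *\<^sub>C x = (\<Sum>k. (c ^ k /\<^sub>R fact k) *\<^sub>C x)"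
    unfolding exp_def by (rule bounded_linear.suminf) (rule summable_exp_generic)
  also have "\<dots> = exp_op A x"
  proof -
    have "(c ^ k /\<^sub>R fact k) *\<^sub>C x = c ^ k *\<^sub>C x /\<^sub>R fact k" for k
      using scaleC_scaleR[of "c ^ k" "inverse (fact k)" x]
      by (simp only: scaleR_conv_of_real mult.commute)
    then show ?thesis by (simp only: exp_op_def pow)
  qed
  finally show ?thesis by simp
qed

lemma exp_op_zero: "exp_op (\<lambda>_. 0) x = x"
proof -
  have "((\<lambda>_. 0) ^^ k) x /\<^sub>R fact k = (if k = 0 then x else 0)" for k
    by (cases k) auto
  then show ?thesis
    unfolding exp_op_def using suminf_finite[of "{0}" "\<lambda>k. if k = 0 then x else 0"] by simp
qed

text \<open>Termwise differentiation of a power series in \<open>t\<close> with vector coefficients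
  \<open>a k\<close>. The derived series is \<open>A\<close> applied to the original one because
  \<open>(k + 1) a (k + 1) = A (a k)\<close>, and it converges uniformly near \<open>t\<close> by
  the Weierstrass test.\<close>

lemma exp_op_has_vector_derivative:
  assumes A: "bounded_linear A"
  shows "((\<lambda>t. exp_op (\<lambda>\<phi>. t *\<^sub>R A \<phi>) x) has_vector_derivative
           A (exp_op (\<lambda>\<phi>. t *\<^sub>R A \<phi>) x)) (at t)"
proof -
  define a where "a k = (A ^^ k) x /\<^sub>R fact k" for k
  obtain K where K: "K \<ge> 0" "\<And>\<psi>. norm (A \<psi>) \<le> norm \<psi> * K"
    using bounded_linear.nonneg_bounded[OF A] by blast
  have bound: "norm ((A ^^ k) x) \<le> K ^ k * norm x" for k
  proof (induction k)
    case (Suc k)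
    have "norm ((A ^^ Suc k) x) \<le> norm ((A ^^ k) x) * K"
      using K(2)[of "(A ^^ k) x"] by simp
    also have "\<dots> \<le> K ^ k * norm x * K"
      using Suc K(1) by (rule mult_right_mono)
    finally show ?case by (simp add: algebra_simps)
  qed simp
  have pow: "((\<lambda>\<phi>. s *\<^sub>R A \<phi>) ^^ k) x = s ^ k *\<^sub>R (A ^^ k) x" for s k
    by (induction k) (simp_all add: linear_scale[OF bounded_linear.linear[OF A]] mult.commute)
  have bl: "bounded_linear (\<lambda>\<phi>. s *\<^sub>R A \<phi>)" for s
    using bounded_linear_scaleR_right A by (rule bounded_linear_compose)
  have sum_exp: "(\<lambda>k. s ^ k *\<^sub>R a k) sums exp_op (\<lambda>\<phi>. s *\<^sub>R A \<phi>) x" for s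
    using summable_exp_op[OF bl[of s], of x] unfolding exp_op_def pow a_def
    by (simp add: summable_sums mult.commute)
  have A_a: "of_nat (Suc k) *\<^sub>R a (Suc k) = A (a k)" for k
    by (simp add: a_def linear_scale[OF bounded_linear.linear[OF A]] del: of_nat_Suc)
  have sum_der: "(\<lambda>k. (of_nat k * s ^ (k - 1)) *\<^sub>R a k) sums A (exp_op (\<lambda>\<phi>. s *\<^sub>R A \<phi>) x)" for s
  proof -
    have "(\<lambda>k. A (s ^ k *\<^sub>R a k)) sums A (exp_op (\<lambda>\<phi>. s *\<^sub>R A \<phi>) x)"
      using A sum_exp by (rule bounded_linear.sums)
    moreover have "A (s ^ k *\<^sub>R a k) = (of_nat (Suc k) * s ^ (Suc k - 1)) *\<^sub>R a (Suc k)" for k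
      using arg_cong[OF A_a[of k], of "\<lambda>v. s ^ k *\<^sub>R v"]
      by (simp add: linear_scale[OF bounded_linear.linear[OF A]] mult.commute del: of_nat_Suc)
    \<comment> \<open>The term at \<open>k = 0\<close> vanishes through the factor
      \<open>of_nat k\<close>, so the index shift changes no sum.\<close>
    ultimately show ?thesis
      using sums_Suc_iff[of "\<lambda>k. (of_nat k * s ^ (k - 1)) *\<^sub>R a k"] by simp
  qed
  \<comment> \<open>\<open>R\<close> bounds the modulus of every \<open>s\<close> in the unit ball
    about \<open>t\<close>, so \<open>B\<close> is a majorant independent of \<open>s\<close>.
    Shifted by one index, \<open>B\<close> is the exponential series of \<open>R * K\<close> times a
    constant.\<close>
  define R where "R = \<bar>t\<bar> + 1"
  define B where "B k = of_nat k * R ^ (k - 1) * (K ^ k * norm x / fact k)" for k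
  have "summable (\<lambda>k. B (Suc k))"
  proof -
    have "B (Suc k) = ((R * K) ^ k /\<^sub>R fact k) * (K * norm x)" for k
      by (simp add: B_def power_mult_distrib field_simps del: of_nat_Suc)
    then show ?thesis
      by (simp only:) (intro summable_mult2 summable_exp_generic)
  qed
  then have summable_B: "summable B" by (simp add: summable_Suc_iff)
  have le_B: "norm ((of_nat k * s ^ (k - 1)) *\<^sub>R a k) \<le> B k" if "s \<in> ball t 1" for k s
  proof -
    have "\<bar>s\<bar> \<le> R" using that by (auto simp: R_def dist_real_def)
    then have "of_nat k * \<bar>s\<bar> ^ (k - 1) \<le> of_nat k * R ^ (k - 1)"
      by (intro mult_left_mono power_mono) auto
    moreover have "norm (a k) \<le> K ^ k * norm x / fact k"
      using bound[of k] by (simp add: a_def field_simps)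
    ultimately have "of_nat k * \<bar>s\<bar> ^ (k - 1) * norm (a k) \<le> B k"
      unfolding B_def by (rule mult_mono) (auto simp: R_def)
    then show ?thesis by (simp add: abs_mult power_abs)
  qed
  have "uniform_limit (ball t 1) (\<lambda>n s. \<Sum>k<n. (of_nat k * s ^ (k - 1)) *\<^sub>R a k)
      (\<lambda>s. \<Sum>k. (of_nat k * s ^ (k - 1)) *\<^sub>R a k) sequentially"
    using le_B summable_B by (rule Weierstrass_m_test)
  then have ul: "uniform_limit (ball t 1) (\<lambda>n s. \<Sum>k<n. (of_nat k * s ^ (k - 1)) *\<^sub>R a k)
      (\<lambda>s. A (exp_op (\<lambda>\<phi>. s *\<^sub>R A \<phi>) x)) sequentially"
    using sums_unique[OF sum_der] by (simp only:)
  have "((\<lambda>s. \<Sum>k. s ^ k *\<^sub>R a k) has_derivative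
      (\<lambda>h. h *\<^sub>R A (exp_op (\<lambda>\<phi>. t *\<^sub>R A \<phi>) x))) (at t within ball t 1)"
  proof -
    have "\<exists>g. \<forall>s\<in>ball t 1. (\<lambda>k. s ^ k *\<^sub>R a k) sums g s \<and>
        (g has_derivative (\<lambda>h. h *\<^sub>R A (exp_op (\<lambda>\<phi>. s *\<^sub>R A \<phi>) x))) (at s within ball t 1)"
    proof (rule has_derivative_series)
      show "((\<lambda>s. s ^ k *\<^sub>R a k) has_derivative (\<lambda>h. h *\<^sub>R (of_nat k * s ^ (k - 1)) *\<^sub>R a k))
          (at s within ball t 1)" for k s
        by (auto intro!: derivative_eq_intros simp: mult_ac)
      show "\<forall>\<^sub>F n in sequentially. \<forall>s\<in>ball t 1. \<forall>h.
          norm ((\<Sum>k<n. h *\<^sub>R (of_nat k * s ^ (k - 1)) *\<^sub>R a k)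
            - h *\<^sub>R A (exp_op (\<lambda>\<phi>. s *\<^sub>R A \<phi>) x)) \<le> e * norm h" if "e > 0" for e
      proof -
        have "\<forall>\<^sub>F n in sequentially. \<forall>s\<in>ball t 1. dist (\<Sum>k<n. (of_nat k * s ^ (k - 1)) *\<^sub>R a k)
            (A (exp_op (\<lambda>\<phi>. s *\<^sub>R A \<phi>) x)) < e"
          using ul that by (rule uniform_limitD)
        then show ?thesis
        proof eventually_elim
          case (elim n)
          show ?case
          proof (intro ballI allI)
            fix s h :: real assume s: "s \<in> ball t 1"
            have "norm ((\<Sum>k<n. h *\<^sub>R (of_nat k * s ^ (k - 1)) *\<^sub>R a k)
                - h *\<^sub>R A (exp_op (\<lambda>\<phi>. s *\<^sub>R A \<phi>) x))
              = \<bar>h\<bar> * dist (\<Sum>k<n. (of_nat k * s ^ (k - 1)) *\<^sub>R a k)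
                (A (exp_op (\<lambda>\<phi>. s *\<^sub>R A \<phi>) x))"
              by (simp only: dist_norm scaleR_sum_right[symmetric] scaleR_diff_right[symmetric]
                  norm_scaleR)
            also have "\<dots> \<le> \<bar>h\<bar> * e"
              using elim s by (intro mult_left_mono) (auto intro: less_imp_le)
            finally show "norm ((\<Sum>k<n. h *\<^sub>R (of_nat k * s ^ (k - 1)) *\<^sub>R a k)
                - h *\<^sub>R A (exp_op (\<lambda>\<phi>. s *\<^sub>R A \<phi>) x)) \<le> e * norm h"
              by (simp add: mult.commute)
          qed
        qed
      qed
      show "(\<lambda>k. t ^ k *\<^sub>R a k) sums exp_op (\<lambda>\<phi>. t *\<^sub>R A \<phi>) x" by (rule sum_exp)
    qed auto
    then obtain g where g: "\<And>s. s \<in> ball t 1 \<Longrightarrow> (\<lambda>k. s ^ k *\<^sub>R a k) sums g s"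
      "(g has_derivative (\<lambda>h. h *\<^sub>R A (exp_op (\<lambda>\<phi>. t *\<^sub>R A \<phi>) x))) (at t within ball t 1)"
      by (metis centre_in_ball zero_less_one)
    show ?thesis
      by (rule has_derivative_transform[OF _ _ g(2)]) (auto simp: sums_unique[OF g(1)])
  qed
  moreover have "(\<lambda>s. \<Sum>k. s ^ k *\<^sub>R a k) = (\<lambda>s. exp_op (\<lambda>\<phi>. s *\<^sub>R A \<phi>) x)"
    using sums_unique[OF sum_exp] by (intro ext) (rule sym)
  ultimately show ?thesis
    by (simp add: has_vector_derivative_def at_within_open[of t "ball t 1"])
qed

subsection \<open>Energy estimate for skew generators\<close>

text \<open>Pairing the equation with \<open>x\<close> removes \<open>G\<close>: the derivative of
  the squared norm is \<open>2 * inner (r t) (x t)\<close>. Hence the norm grows at rate at most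
  \<open>c\<close>.\<close>

lemma norm_le_of_skew_ode:
  fixes x :: "real \<Rightarrow> 'a::real_inner"
  assumes skew: "\<And>v. inner (G v) v = 0"
    and der: "\<And>t. (x has_vector_derivative G (x t) + r t) (at t)"
    and r: "\<And>t. t \<in> {0..T} \<Longrightarrow> norm (r t) \<le> c" and "0 \<le> T"
  shows "norm (x T) \<le> norm (x 0) + c * T"
proof (rule field_le_epsilon)
  fix e :: real assume "e > 0"
  have c: "0 \<le> c" using order_trans[OF norm_ge_zero r[of 0]] \<open>0 \<le> T\<close> by simp
  \<comment> \<open>The summand \<open>e\<^sup>2\<close> keeps the square root differentiable where
    \<open>x\<close> vanishes. It raises the initial value by at most \<open>e\<close>, which is the
    slack allowed in the goal.\<close>
  define y where "y t = sqrt (inner (x t) (x t) + e\<^sup>2)" for t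
  have pos: "inner (x t) (x t) + e\<^sup>2 > 0" for t
    using \<open>e > 0\<close> by (intro add_nonneg_pos) auto
  have y_der: "(y has_real_derivative inner (r t) (x t) / y t) (at t)" for t
  proof -
    have "((\<lambda>t. inner (x t) (x t)) has_derivative
        (\<lambda>h. inner (x t) (h *\<^sub>R (G (x t) + r t)) + inner (h *\<^sub>R (G (x t) + r t)) (x t))) (at t)"
      using der[of t] unfolding has_vector_derivative_def by (intro has_derivative_inner) auto
    moreover have "inner (x t) (h *\<^sub>R (G (x t) + r t)) + inner (h *\<^sub>R (G (x t) + r t)) (x t)
        = (2 * inner (r t) (x t)) * h" for h
      using skew[of "x t"] by (simp add: inner_add_left inner_add_right inner_commute)
    ultimately have "((\<lambda>t. inner (x t) (x t)) has_real_derivative 2 * inner (r t) (x t)) (at t)"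
      by (simp add: has_field_derivative_def)
    then have "((\<lambda>t. sqrt (inner (x t) (x t) + e\<^sup>2)) has_real_derivative
        2 * inner (r t) (x t) * (inverse (sqrt (inner (x t) (x t) + e\<^sup>2)) / 2)) (at t)"
      using pos[of t] by (auto intro!: derivative_eq_intros)
    moreover have "y = (\<lambda>t. sqrt (inner (x t) (x t) + e\<^sup>2))"
      by (rule ext) (rule y_def)
    ultimately show ?thesis by (simp add: field_simps)
  qed
  have y_pos: "y t > 0" and x_le_y: "norm (x t) \<le> y t" for t
  proof -
    show "y t > 0" unfolding y_def using pos by (rule real_sqrt_gt_zero)
    show "norm (x t) \<le> y t"
      unfolding y_def norm_eq_sqrt_inner[of "x t"] by (rule real_sqrt_le_mono) simp
  qed
  have "y T - c * T \<le> y 0 - c * 0"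
  proof (rule DERIV_nonpos_imp_nonincreasing[OF \<open>0 \<le> T\<close>])
    fix t assume t: "0 \<le> t" "t \<le> T"
    have "inner (r t) (x t) \<le> norm (r t) * norm (x t)"
      by (rule norm_cauchy_schwarz)
    also have "\<dots> \<le> c * y t"
      using r[of t] t c x_le_y[of t] by (intro mult_mono) auto
    finally have "inner (r t) (x t) / y t - c \<le> 0"
      using y_pos[of t] by (simp add: divide_le_eq)
    moreover have "((\<lambda>t. y t - c * t) has_real_derivative inner (r t) (x t) / y t - c) (at t)"
      by (auto intro!: derivative_eq_intros y_der)
    ultimately show "\<exists>d. ((\<lambda>t. y t - c * t) has_real_derivative d) (at t) \<and> d \<le> 0"
      by blast
  qed
  moreover have "y 0 \<le> norm (x 0) + e"
    using \<open>e > 0\<close> sqrt_add_le_add_sqrt[of "inner (x 0) (x 0)" "e\<^sup>2"]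
    unfolding y_def norm_eq_sqrt_inner[of "x 0"] by simp
  ultimately show "norm (x T) \<le> norm (x 0) + c * T + e"
    using x_le_y[of T] by simp
qed

text \<open>The energy estimate without forcing. It serves both signs of the generator, hence both
  propagators in the Heisenberg picture.\<close>

lemma norm_exp_op_skew_le:
  assumes "bounded_linear G" and "\<And>v. inner (G v) v = 0" and "0 \<le> T"
  shows "norm (exp_op (\<lambda>\<phi>. T *\<^sub>R G \<phi>) x) \<le> norm x"
  using norm_le_of_skew_ode[of G "\<lambda>t. exp_op (\<lambda>\<phi>. t *\<^sub>R G \<phi>) x" "\<lambda>_. 0" T 0]
    exp_op_has_vector_derivative[OF assms(1)] assms(2,3)
  by (simp add: exp_op_zero)

text \<open>The commutator of \<open>M\<close> with the exponential, applied to \<open>x\<close>,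
  vanishes at time 0. It solves the equation of the energy estimate with forcing
  \<open>[M, G]\<close> applied to the evolved vector.\<close>

lemma norm_commutator_exp_op_le:
  assumes G: "bounded_linear G" and skew: "\<And>v. inner (G v) v = 0" and M: "bounded_linear M"
    and "0 \<le> T"
    and c: "\<And>t. t \<in> {0..T} \<Longrightarrow>
      norm (M (G (exp_op (\<lambda>\<phi>. t *\<^sub>R G \<phi>) x)) - G (M (exp_op (\<lambda>\<phi>. t *\<^sub>R G \<phi>) x))) \<le> c"
  shows "norm (M (exp_op (\<lambda>\<phi>. T *\<^sub>R G \<phi>) x) - exp_op (\<lambda>\<phi>. T *\<^sub>R G \<phi>) (M x)) \<le> c * T"
proof -
  let ?e = "\<lambda>t. exp_op (\<lambda>\<phi>. t *\<^sub>R G \<phi>)"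
  have "((\<lambda>t. M (?e t x) - ?e t (M x)) has_vector_derivative
      G (M (?e t x) - ?e t (M x)) + (M (G (?e t x)) - G (M (?e t x)))) (at t)" for t
  proof -
    have "((\<lambda>t. M (?e t x) - ?e t (M x)) has_vector_derivative
        M (G (?e t x)) - G (?e t (M x))) (at t)"
      by (intro has_vector_derivative_diff exp_op_has_vector_derivative[OF G]
          bounded_linear.has_vector_derivative[OF M])
    then show ?thesis
      by (simp add: linear_diff[OF bounded_linear.linear[OF G]])
  qed
  from norm_le_of_skew_ode[of G _ _ T c, OF skew this c \<open>0 \<le> T\<close>] show ?thesis
    by (simp add: exp_op_zero)
qed


subsection \<open>Commutators with truncated coordinates\<close>

lift_definition shift :: "'a::ab_group_add \<Rightarrow> 'a ell2 \<Rightarrow> 'a ell2" is "\<lambda>v f n. f (n + v)"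
  by (rule square_summable_shift)

lemma bij_add_right: "bij_betw (\<lambda>n. n + v) UNIV (UNIV :: 'a::ab_group_add set)"
  by (rule bij_betw_byWitness[where f' = "\<lambda>n. n - v"]) auto

lemma norm_shift [simp]: "norm (shift v x) = norm x"
  using infsum_reindex_bij_betw[OF bij_add_right, of "\<lambda>n. (cmod (apply_ell2 x n))\<^sup>2" v]
  by (simp add: norm_ell2 shift.rep_eq)

lemma inner_shift_left: "inner (shift v x) y = inner x (shift (- v) y)"
  using infsum_reindex_bij_betw[OF bij_add_right,
      of "\<lambda>n. inner (apply_ell2 x n) (apply_ell2 y (n - v))" v]
  by (simp add: inner_ell2_def shift.rep_eq)

lemma apply_ell2_sum: "apply_ell2 (\<Sum>j\<in>J. g j) n = (\<Sum>j\<in>J. apply_ell2 (g j) n)"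
  by (induction J rule: infinite_finite_induct) (auto simp: zero_ell2.rep_eq plus_ell2.rep_eq)

lemma laplacian_eq_shifts: "laplacian x = (\<Sum>j\<in>UNIV. shift (axis j 1) x + shift (- axis j 1) x)"
  by (rule ell2_eqI) (simp add: laplacian.rep_eq apply_ell2_sum shift.rep_eq plus_ell2.rep_eq)

text \<open>The adjoint of a shift is the opposite shift, and the Laplacian contains both shifts of
  each pair.\<close>

lemma inner_laplacian_left: "inner (laplacian x) y = inner x (laplacian y)"
proof -
  have "inner (shift v x + shift (- v) x) y = inner x (shift v y + shift (- v) y)" for v
    unfolding inner_add_left inner_add_right inner_shift_left by simp
  then show ?thesis
    unfolding laplacian_eq_shifts inner_sum_left inner_sum_right by (intro sum.cong) auto
qed

lemma inner_schroedinger_left: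
  assumes "bounded (range V)"
  shows "inner (schroedinger V x) y = inner x (schroedinger V y)"
proof -
  obtain c where "\<And>n. norm (V n) \<le> c"
    using assms by (auto simp: bounded_iff)
  then have "z \<in> mult_domain (\<lambda>n. complex_of_real (V n))" for z
    using mult_domain_bounded[of "\<lambda>n. complex_of_real (V n)" c] by auto
  then have "inner (mult_op (\<lambda>n. complex_of_real (V n)) x) y =
      inner x (mult_op (\<lambda>n. complex_of_real (V n)) y)"
    by (simp add: inner_ell2_def apply_mult_op inner_complex_def algebra_simps)
  then show ?thesis
    by (simp add: schroedinger_def inner_add_left inner_add_right inner_laplacian_left)
qed

lemma schroedinger_scaleC:
  assumes "bounded (range V)"
  shows "schroedinger V (a *\<^sub>C x) = a *\<^sub>C schroedinger V x"
proof -
  obtain c where "\<And>n. norm (V n) \<le> c"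
    using assms by (auto simp: bounded_iff)
  then have "z \<in> mult_domain (\<lambda>n. complex_of_real (V n))" for z
    using mult_domain_bounded[of "\<lambda>n. complex_of_real (V n)" c] by auto
  then show ?thesis
    by (intro ell2_eqI) (simp add: schroedinger_def plus_ell2.rep_eq laplacian.rep_eq scaleC.rep_eq
        apply_mult_op sum_distrib_left algebra_simps)
qed

text \<open>For imaginary \<open>c\<close>, \<open>cnj c = - c\<close>. Symmetry and complex
  linearity then make the inner product equal to its own negative.\<close>

lemma skew_schroedinger:
  assumes "bounded (range V)" and "Re c = 0"
  shows "inner (c *\<^sub>C schroedinger V x) x = 0"
proof -
  have c: "cnj c = - c" using assms(2) by (simp add: complex_eq_iff)
  have "inner (c *\<^sub>C schroedinger V x) x = inner (schroedinger V x) (- c *\<^sub>C x)"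
    by (simp add: inner_scaleC_left c)
  also have "\<dots> = inner x (- c *\<^sub>C schroedinger V x)"
    by (simp add: inner_schroedinger_left schroedinger_scaleC assms(1))
  also have "\<dots> = - inner (c *\<^sub>C schroedinger V x) x"
    by (simp add: ell2.scale_minus_left inner_commute)
  finally show ?thesis by simp
qed

abbreviation mult_coord :: "'m \<Rightarrow> (int \<Rightarrow> real) \<Rightarrow> (int ^ 'm) ell2 \<Rightarrow> (int ^ 'm) ell2" where
  "mult_coord j g \<equiv> mult_op (\<lambda>n. complex_of_real (g (n $ j)))"

text \<open>The potential commutes with multiplication by \<open>g\<close> and cancels, and a hop
  along another axis leaves coordinate \<open>j\<close> unchanged. What remains is one hop in each
  direction along axis \<open>j\<close>, weighted by an increment of \<open>g\<close>. Each weight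
  is at most 1 and vanishes unless both ends of the hop lie in \<open>L\<close>; the two hops give
  the factor 2.\<close>

lemma commutator_schroedinger_le:
  fixes V :: "int ^ 'm \<Rightarrow> real"
  assumes V: "bounded (range V)" and g: "\<And>k. \<bar>g k\<bar> \<le> b"
    and step: "\<And>k. \<bar>g (k + 1) - g k\<bar> \<le> min (indicator L k) (indicator L (k + 1))"
  shows "norm (mult_coord j g (schroedinger V x) - schroedinger V (mult_coord j g x))
    \<le> 2 * norm (mult_coord j (indicator L) x)"
proof -
  obtain c where "\<And>n. norm (V n) \<le> c"
    using V by (auto simp: bounded_iff)
  then have DV: "z \<in> mult_domain (\<lambda>n. complex_of_real (V n))" for z
    using mult_domain_bounded[of "\<lambda>n. complex_of_real (V n)" c] by auto
  have Dg: "z \<in> mult_domain (\<lambda>n. complex_of_real (g (n $ j)))" for z :: "(int ^ 'm) ell2"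
    using mult_domain_bounded[of "\<lambda>n :: int ^ 'm. complex_of_real (g (n $ j))" b] g by auto
  have DL: "z \<in> mult_domain (\<lambda>n. complex_of_real (indicator L (n $ j)))" for z :: "(int ^ 'm) ell2"
    using mult_domain_bounded[of "\<lambda>n :: int ^ 'm. complex_of_real (indicator L (n $ j))" 1]
    by (auto simp: indicator_def)
  define d where "d s n = complex_of_real (g (n $ j) - g (n $ j + s))" for s and n :: "int ^ 'm"
  \<comment> \<open>The indicator is taken at the far end \<open>n $ j + s\<close> because the
    shifted vector is evaluated there. For \<open>s = -1\<close> the increment is the one starting
    at \<open>n $ j - 1\<close>.\<close>
  have d_le: "cmod (d s n) \<le> indicator L (n $ j + s)" if "s \<in> {1, -1}" for s n
    using that step[of "n $ j"] step[of "n $ j - 1"] by (auto simp: d_def norm_of_real simp del: of_real_diff)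
  then have "cmod (d s n) \<le> 1" if "s \<in> {1, -1}" for s n
    using that order_trans indicator_le_1 by metis
  then have Dd: "z \<in> mult_domain (d s)" if "s \<in> {1, -1}" for s z
    using that mult_domain_bounded[of "d s" 1] by auto
  have "norm (mult_op (d s) (shift (axis j s) x)) \<le> norm (shift (axis j s) (mult_coord j (indicator L) x))"
    if "s \<in> {1, -1}" for s
    using d_le[OF that]
    by (intro norm_ell2_mono)
       (simp add: apply_mult_op Dd[OF that] DL shift.rep_eq norm_mult mult_right_mono)
  then have le: "norm (mult_op (d s) (shift (axis j s) x)) \<le> norm (mult_coord j (indicator L) x)"
    if "s \<in> {1, -1}" for s using that by simp
  have "mult_coord j g (schroedinger V x) - schroedinger V (mult_coord j g x)
    = mult_op (d 1) (shift (axis j 1) x) + mult_op (d (-1)) (shift (axis j (-1)) x)" (is "?l = ?r")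
  proof (rule ell2_eqI)
    fix n
    let ?t = "\<lambda>i. (of_real (g (n $ j)) - of_real (g ((n + axis i 1) $ j))) * apply_ell2 x (n + axis i 1)
       + (of_real (g (n $ j)) - of_real (g ((n - axis i 1) $ j))) * apply_ell2 x (n - axis i 1)"
    have "apply_ell2 ?l n = (\<Sum>i\<in>UNIV. ?t i)"
      by (simp add: minus_ell2.rep_eq plus_ell2.rep_eq schroedinger_def apply_mult_op Dg DV
          laplacian.rep_eq sum_distrib_left sum_subtractf[symmetric] algebra_simps
          del: sum_subtractf vector_add_component vector_minus_component)
    \<comment> \<open>For \<open>i \<noteq> j\<close> a hop along axis \<open>i\<close> does not
      change coordinate \<open>j\<close>, so both differences are zero.\<close>
    also have "\<dots> = (\<Sum>i\<in>{j}. ?t i)"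
      by (rule sum.mono_neutral_right) (auto simp: axis_def)
    also have "\<dots> = apply_ell2 ?r n"
    proof -
      have "axis j (- 1) = - axis j (1::int)" by (simp add: axis_def vec_eq_iff)
      then show ?thesis
        by (simp add: plus_ell2.rep_eq apply_mult_op Dd shift.rep_eq d_def)
    qed
    finally show "apply_ell2 ?l n = apply_ell2 ?r n" .
  qed
  then show ?thesis
    using norm_triangle_ineq[of "mult_op (d 1) (shift (axis j 1) x)"] le[of 1] le[of "-1"]
    by (smt (verit) insertCI)
qed

section \<open>Clamped coordinates and tails\<close>

text \<open>Clamping, as opposed to cutting off to zero, gives a bounded function whose increments
  are at most 1 for every \<open>S\<close>. This makes the commutator bounds uniform in the
  truncation.\<close>

definition clamp_int :: "int \<Rightarrow> int \<Rightarrow> real" where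
  "clamp_int S k = of_int (max (- S) (min S k))"

lemma abs_clamp_int_le: "0 \<le> S \<Longrightarrow> \<bar>clamp_int S k\<bar> \<le> of_int S"
  by (auto simp: clamp_int_def)

lemma abs_clamp_int_le_abs: "0 \<le> S \<Longrightarrow> \<bar>clamp_int S k\<bar> \<le> \<bar>of_int k\<bar>"
  by (auto simp: clamp_int_def)

lemma clamp_int_eq: "\<bar>k\<bar> \<le> S \<Longrightarrow> clamp_int S k = of_int k"
  by (auto simp: clamp_int_def)

lemma clamp_int_step: "\<bar>clamp_int S (k + 1) - clamp_int S k\<bar> \<le> 1"
proof -
  have "\<bar>max (- S) (min S (k + 1)) - max (- S) (min S k)\<bar> \<le> 1" by linarith
  then show ?thesis unfolding clamp_int_def by linarith
qed

text \<open>The two clamps agree for \<bar>k\<bar> \<le> R. A site with \<bar>k\<bar> < R has all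
  its neighbours in that range, so their difference changes only along steps with both ends in the
  set R \<le> \<bar>k\<bar>.\<close>

lemma clamp_int_diff_step:
  assumes "0 \<le> R" "R \<le> S"
  shows "\<bar>(clamp_int S (k + 1) - clamp_int R (k + 1)) - (clamp_int S k - clamp_int R k)\<bar>
    \<le> min (indicator {k. R \<le> \<bar>k\<bar>} k) (indicator {k. R \<le> \<bar>k\<bar>} (k + 1))"
proof -
  define d where "d = (max (- S) (min S (k + 1)) - max (- R) (min R (k + 1))) -
    (max (- S) (min S k) - max (- R) (min R k))"
  have "\<bar>d\<bar> \<le> 1"
    using assms by (simp add: d_def max_def min_def)
  moreover have "d = 0" if "\<bar>k\<bar> < R \<or> \<bar>k + 1\<bar> < R"
    using assms that by (auto simp: d_def max_def min_def)
  moreover have "(clamp_int S (k + 1) - clamp_int R (k + 1)) - (clamp_int S k - clamp_int R k)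
    = of_int d"
    by (simp add: d_def clamp_int_def)
  ultimately show ?thesis
    by (cases "\<bar>k\<bar> < R \<or> \<bar>k + 1\<bar> < R") (simp_all add: not_less flip: of_int_abs)
qed

text \<open>On a finite set of sites a clamp at a high enough level is exact, so the uniform bound
  controls every finite partial sum of the squared norm. Both the domain membership and the norm
  bound follow.\<close>

lemma position_of_clamp_bound:
  assumes c: "\<And>S. 0 \<le> S \<Longrightarrow> norm (mult_coord j (clamp_int S) x) \<le> c"
  shows "x \<in> position_domain j" and "norm (position j x) \<le> c"
proof -
  have D: "x \<in> mult_domain (\<lambda>n. complex_of_real (clamp_int S (n $ j)))" if "0 \<le> S" for S
    using mult_domain_bounded[of "\<lambda>n. complex_of_real (clamp_int S (n $ j))" "of_int S"]
      abs_clamp_int_le[OF that] by auto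
  have fin: "(\<Sum>n\<in>F. (cmod (of_int (n $ j) * apply_ell2 x n))\<^sup>2) \<le> c\<^sup>2" if F: "finite F" for F
  proof -
    \<comment> \<open>Inserting 0 makes the maximum defined for empty \<open>F\<close> and ensures
      \<open>0 \<le> S\<close>.\<close>
    define S where "S = Max (insert 0 ((\<lambda>n. \<bar>n $ j\<bar>) ` F))"
    have S: "0 \<le> S" "\<And>n. n \<in> F \<Longrightarrow> \<bar>n $ j\<bar> \<le> S"
      using F by (auto simp: S_def)
    have "(\<Sum>n\<in>F. (cmod (of_int (n $ j) * apply_ell2 x n))\<^sup>2) =
        (\<Sum>n\<in>F. (cmod (apply_ell2 (mult_coord j (clamp_int S) x) n))\<^sup>2)"
      by (rule sum.cong) (simp_all add: apply_mult_op D S clamp_int_eq)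
    also have "\<dots> \<le> (norm (mult_coord j (clamp_int S) x))\<^sup>2"
      using F by (rule sum_le_norm_ell2)
    also have "\<dots> \<le> c\<^sup>2"
      using c[OF S(1)] by (intro power_mono) auto
    finally show ?thesis .
  qed
  have "square_summable (\<lambda>n. of_int (n $ j) * apply_ell2 x n)"
    unfolding square_summable_def
    by (rule nonneg_bdd_above_summable_on) (auto intro!: bdd_aboveI[of _ "c\<^sup>2"] dest: fin)
  then show dom: "x \<in> position_domain j"
    by (simp add: position_domain_def mult_domain_def)
  have "0 \<le> c" using c[of 0] norm_ge_zero order_trans by blast
  then show "norm (position j x) \<le> c"
    using fin dom
    by (intro norm_ell2_leI) (simp_all add: position_def position_domain_def apply_mult_op)
qed

lemma norm_clamp_le_position:
  assumes "x \<in> position_domain j" "0 \<le> S"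
  shows "norm (mult_coord j (clamp_int S) x) \<le> norm (position j x)"
proof (rule norm_ell2_mono)
  fix n
  have "x \<in> mult_domain (\<lambda>n. complex_of_real (clamp_int S (n $ j)))"
    using mult_domain_bounded[of "\<lambda>n. complex_of_real (clamp_int S (n $ j))" "of_int S"]
      abs_clamp_int_le[OF assms(2)] by auto
  then show "cmod (apply_ell2 (mult_coord j (clamp_int S) x) n) \<le> cmod (apply_ell2 (position j x) n)"
    using assms abs_clamp_int_le_abs[OF assms(2), of "n $ j"]
    by (simp add: position_def position_domain_def apply_mult_op norm_mult mult_right_mono)
qed

text \<open>All but \<open>e\<^sup>2\<close> of the squared mass sits on a finite set of sites, and
  the region R \<le> \<bar>n $ j\<bar> misses that set once \<open>R\<close> is large.\<close>

lemma tail_small: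
  assumes "e > 0"
  obtains R where "0 \<le> R" "norm (mult_coord j (indicator {k. R \<le> \<bar>k\<bar>}) x) \<le> e"
proof -
  let ?f = "\<lambda>n. (cmod (apply_ell2 x n))\<^sup>2"
  have sm: "?f summable_on UNIV"
    using square_summable_apply_ell2 by (simp add: square_summable_def)
  then have "(sum ?f \<longlongrightarrow> infsum ?f UNIV) (finite_subsets_at_top UNIV)"
    by (simp add: has_sum_def[symmetric])
  then have "\<forall>\<^sub>F F in finite_subsets_at_top UNIV. dist (sum ?f F) (infsum ?f UNIV) < e\<^sup>2"
    using assms by (intro tendstoD) auto
  then obtain F where F: "finite F" "dist (sum ?f F) (infsum ?f UNIV) < e\<^sup>2"
    unfolding eventually_finite_subsets_at_top by blast
  \<comment> \<open>Adding 1 makes the bound on \<open>F\<close> strict, so that \<open>F\<close> is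
    disjoint from the region where the indicator is 1.\<close>
  define R where "R = Max (insert 0 ((\<lambda>n. \<bar>n $ j\<bar>) ` F)) + 1"
  have R: "0 \<le> R" "\<And>n. n \<in> F \<Longrightarrow> \<bar>n $ j\<bar> < R"
    using F(1) by (auto simp: R_def zless_add1_eq intro: add_nonneg_nonneg)
  let ?L = "{k. R \<le> \<bar>k\<bar>}"
  have D: "x \<in> mult_domain (\<lambda>n. complex_of_real (indicator ?L (n $ j)))"
    using mult_domain_bounded[of "\<lambda>n. complex_of_real (indicator ?L (n $ j))" 1]
    by (auto simp: indicator_def)
  have "norm (mult_coord j (indicator ?L) x) \<le> e"
  proof (rule norm_ell2_leI)
    fix F' :: "(int ^ 'a) set" assume F': "finite F'"
    have "(\<Sum>n\<in>F'. (cmod (apply_ell2 (mult_coord j (indicator ?L) x) n))\<^sup>2) \<le> sum ?f (F' - F)"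
    proof -
      have "(\<Sum>n\<in>F'. (cmod (apply_ell2 (mult_coord j (indicator ?L) x) n))\<^sup>2) =
          (\<Sum>n\<in>F' - F. (cmod (apply_ell2 (mult_coord j (indicator ?L) x) n))\<^sup>2)"
        using F' R(2) by (intro sum.mono_neutral_right) (force simp: apply_mult_op[OF D])+
      also have "\<dots> \<le> sum ?f (F' - F)"
        by (rule sum_mono) (auto simp: apply_mult_op[OF D] split: split_indicator)
      finally show ?thesis .
    qed
    also have "\<dots> = sum ?f (F' \<union> F) - sum ?f F"
      using F' F(1) sum.union_disjoint[of "F' - F" F ?f]
      by (simp add: Un_Diff_cancel2 Diff_Int_distrib2)
    also have "sum ?f (F' \<union> F) \<le> infsum ?f UNIV"
      using sm F' F(1) by (intro finite_sum_le_infsum) auto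
    finally show "(\<Sum>n\<in>F'. (cmod (apply_ell2 (mult_coord j (indicator ?L) x) n))\<^sup>2) \<le> e\<^sup>2"
      using F(2) by (simp add: dist_real_def)
  qed (use assms in simp)
  with R(1) show ?thesis using that by blast
qed

subsection \<open>Sublinear growth on the pure point subspace\<close>

definition generator :: "(int ^ 'm \<Rightarrow> real) \<Rightarrow> (int ^ 'm) ell2 \<Rightarrow> (int ^ 'm) ell2" where
  "generator V x = - \<i> *\<^sub>C schroedinger V x"

text \<open>This is exp(-iTH). The real time stands outside the fixed generator, the form in which
  the differential equation and the energy estimate are stated.\<close>

definition evolution :: "(int ^ 'm \<Rightarrow> real) \<Rightarrow> real \<Rightarrow> (int ^ 'm) ell2 \<Rightarrow> (int ^ 'm) ell2" where
  "evolution V T = exp_op (\<lambda>\<phi>. T *\<^sub>R generator V \<phi>)"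

definition evolution_comm ::
  "(int ^ 'm \<Rightarrow> real) \<Rightarrow> 'm \<Rightarrow> (int \<Rightarrow> real) \<Rightarrow> real \<Rightarrow> (int ^ 'm) ell2 \<Rightarrow> (int ^ 'm) ell2" where
  "evolution_comm V j g T x = mult_coord j g (evolution V T x) - evolution V T (mult_coord j g x)"

lemma bounded_linear_mult_coord:
  assumes "\<And>k. \<bar>g k\<bar> \<le> b"
  shows "bounded_linear (mult_coord j g)"
  using assms by (intro bounded_linear_mult_op[where c = b]) simp

lemma mult_op_scaleC:
  assumes "bounded (range f)"
  shows "mult_op f (c *\<^sub>C x) = c *\<^sub>C mult_op f x"
proof -
  obtain b where "\<And>n. cmod (f n) \<le> b"
    using assms by (auto simp: bounded_iff)
  then have "z \<in> mult_domain f" for z using mult_domain_bounded[of f b] by auto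
  then show ?thesis by (intro ell2_eqI) (simp add: apply_mult_op scaleC.rep_eq)
qed

context
  fixes V :: "int ^ 'm \<Rightarrow> real"
  assumes V: "bounded (range V)"
begin

lemma bounded_linear_generator: "bounded_linear (generator V)"
  unfolding generator_def[abs_def] by (intro bounded_linear_scaleC bounded_linear_schroedinger V)

lemma bounded_linear_scaled_generator: "bounded_linear (\<lambda>\<phi>. T *\<^sub>R generator V \<phi>)"
  using bounded_linear_scaleR_right bounded_linear_generator by (rule bounded_linear_compose)

lemma generator_skew: "inner (generator V x) x = 0"
  unfolding generator_def by (rule skew_schroedinger) (simp_all add: V)

lemma scaled_generator_scaleC: "T *\<^sub>R generator V (c *\<^sub>C x) = c *\<^sub>C (T *\<^sub>R generator V x)"
proof -
  have "generator V (c *\<^sub>C x) = c *\<^sub>C generator V x"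
    unfolding generator_def schroedinger_scaleC[OF V] ell2.scale_scale by (simp only: mult.commute)
  then show ?thesis
    by (simp only: linear_scale[OF bounded_linear.linear[OF bounded_linear_scaleC_id]])
qed

lemma norm_evolution_le: "0 \<le> T \<Longrightarrow> norm (evolution V T x) \<le> norm x"
  unfolding evolution_def
  by (rule norm_exp_op_skew_le) (simp_all add: bounded_linear_generator generator_skew)

lemma evolution_add: "evolution V T (x + y) = evolution V T x + evolution V T y"
  unfolding evolution_def by (rule exp_op_additive[OF bounded_linear_scaled_generator])

lemma evolution_scaleC: "evolution V T (c *\<^sub>C x) = c *\<^sub>C evolution V T x"
  unfolding evolution_def
  using exp_op_intertwine[of "\<lambda>\<phi>. T *\<^sub>R generator V \<phi>" "\<lambda>x. c *\<^sub>C x" x,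
      OF bounded_linear_scaled_generator bounded_linear_scaleC_id scaled_generator_scaleC[symmetric]]
  by (rule sym)

text \<open>The eigenvalue \<open>E\<close> is an arbitrary complex number here. The bound on the
  factor \<open>c\<close> comes from contractivity of the evolution on the nonzero vector
  \<open>x\<close>.\<close>

lemma evolution_eigenvector:
  assumes "eigenvector (schroedinger V) x" "0 \<le> T"
  obtains c where "cmod c \<le> 1" "evolution V T x = c *\<^sub>C x"
proof -
  obtain E where "x \<noteq> 0" and E: "schroedinger V x = E *\<^sub>C x"
    using assms(1) by (auto simp: eigenvector_def)
  have "T *\<^sub>R generator V x = (- \<i> * E * of_real T) *\<^sub>C x"
    unfolding generator_def E scaleC_scaleR by simp
  then have eq: "evolution V T x = exp (- \<i> * E * of_real T) *\<^sub>C x"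
    unfolding evolution_def
    by (rule exp_op_eigenvector[OF bounded_linear_scaled_generator _ scaled_generator_scaleC])
  moreover have "cmod (exp (- \<i> * E * of_real T)) \<le> 1"
    using norm_evolution_le[OF assms(2), of x] \<open>x \<noteq> 0\<close>
    unfolding eq norm_scaleC by (simp add: mult_le_cancel_right1)
  ultimately show ?thesis using that by blast
qed

text \<open>The factor \<open>- \<i>\<close> has modulus 1, so the forcing is as large as the
  commutator with the Schroedinger operator. That is at most twice the part of the evolved vector
  lying over \<open>L\<close>.\<close>

lemma evolution_comm_le:
  assumes g: "\<And>k. \<bar>g k\<bar> \<le> b" and "0 \<le> T"
    and step: "\<And>k. \<bar>g (k + 1) - g k\<bar> \<le> min (indicator L k) (indicator L (k + 1))"
    and c: "\<And>t. t \<in> {0..T} \<Longrightarrow> norm (mult_coord j (indicator L) (evolution V t x)) \<le> c"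
  shows "norm (evolution_comm V j g T x) \<le> 2 * c * T"
  unfolding evolution_comm_def evolution_def
proof (rule norm_commutator_exp_op_le[OF bounded_linear_generator generator_skew
      bounded_linear_mult_coord[OF g] \<open>0 \<le> T\<close>])
  fix t assume t: "t \<in> {0..T}"
  define y where "y = exp_op (\<lambda>\<phi>. t *\<^sub>R generator V \<phi>) x"
  have "bounded (range (\<lambda>n :: int ^ 'm. complex_of_real (g (n $ j))))"
    using g by (auto simp: bounded_iff)
  then have "mult_coord j g (generator V y) - generator V (mult_coord j g y) =
      - \<i> *\<^sub>C (mult_coord j g (schroedinger V y) - schroedinger V (mult_coord j g y))"
    unfolding generator_def by (simp only: mult_op_scaleC ell2.scale_right_diff_distrib)
  then have "norm (mult_coord j g (generator V y) - generator V (mult_coord j g y)) =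
      norm (mult_coord j g (schroedinger V y) - schroedinger V (mult_coord j g y))"
    by (simp only: norm_scaleC) simp
  also have "\<dots> \<le> 2 * norm (mult_coord j (indicator L) y)"
    by (rule commutator_schroedinger_le[OF V g step])
  also have "\<dots> \<le> 2 * c"
    using c[OF t] by (simp add: y_def evolution_def)
  finally show "norm (mult_coord j g (generator V (exp_op (\<lambda>\<phi>. t *\<^sub>R generator V \<phi>) x)) -
      generator V (mult_coord j g (exp_op (\<lambda>\<phi>. t *\<^sub>R generator V \<phi>) x))) \<le> 2 * c"
    by (simp add: y_def)
qed

text \<open>The ballistic bound, with \<open>L = UNIV\<close>. Its independence of \<open>S\<close>
  is what permits both approximation in norm and removal of the clamp.\<close>

lemma evolution_comm_clamp_le:
  assumes "0 \<le> S" "0 \<le> T"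
  shows "norm (evolution_comm V j (clamp_int S) T x) \<le> 2 * norm x * T"
proof (rule evolution_comm_le[where L = UNIV])
  show "norm (mult_coord j (indicator UNIV) (evolution V t x)) \<le> norm x" if "t \<in> {0..T}" for t
    using norm_mult_op_le[of "\<lambda>n :: int ^ 'm. complex_of_real (indicator UNIV (n $ j))" 1 "evolution V t x"]
      norm_evolution_le[of t x] that by simp
qed (use assms abs_clamp_int_le clamp_int_step in auto)

lemma evolution_comm_add:
  assumes "\<And>k. \<bar>g k\<bar> \<le> b"
  shows "evolution_comm V j g T (x + y) = evolution_comm V j g T x + evolution_comm V j g T y"
  unfolding evolution_comm_def evolution_add
    linear_add[OF bounded_linear.linear[OF bounded_linear_mult_coord[of g b, OF assms]]]
  by (rule add_diff_add)

lemma evolution_comm_scaleC: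
  assumes "\<And>k. \<bar>g k\<bar> \<le> b"
  shows "evolution_comm V j g T (c *\<^sub>C x) = c *\<^sub>C evolution_comm V j g T x"
proof -
  have "bounded (range (\<lambda>n :: int ^ 'm. complex_of_real (g (n $ j))))"
    using assms by (auto simp: bounded_iff)
  then show ?thesis
    by (simp only: evolution_comm_def evolution_scaleC mult_op_scaleC ell2.scale_right_diff_distrib)
qed

lemma evolution_comm_clamp_crude:
  assumes "0 \<le> S" "0 \<le> T"
  shows "norm (evolution_comm V j (clamp_int S) T x) \<le> 2 * of_int S * norm x"
proof -
  have le: "norm (mult_coord j (clamp_int S) y) \<le> of_int S * norm y" for y :: "(int ^ 'm) ell2"
    using abs_clamp_int_le[OF assms(1)] by (intro norm_mult_op_le) simp
  have "norm (evolution_comm V j (clamp_int S) T x) \<le>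
      norm (mult_coord j (clamp_int S) (evolution V T x)) +
      norm (evolution V T (mult_coord j (clamp_int S) x))"
    unfolding evolution_comm_def by (rule norm_triangle_ineq4)
  also have "\<dots> \<le> of_int S * norm x + of_int S * norm x"
  proof (rule add_mono)
    show "norm (mult_coord j (clamp_int S) (evolution V T x)) \<le> of_int S * norm x"
      using le[of "evolution V T x"] norm_evolution_le[OF assms(2), of x] assms(1)
      by (meson mult_left_mono of_int_0_le_iff order_trans)
    show "norm (evolution V T (mult_coord j (clamp_int S) x)) \<le> of_int S * norm x"
      using norm_evolution_le[OF assms(2)] le order_trans by blast
  qed
  finally show ?thesis by simp
qed

text \<open>An eigenvector only acquires a factor of modulus at most 1, so its mass beyond
  \<open>R\<close> never grows. The clamp at \<open>R\<close> contributes a term constant in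
  \<open>T\<close>, and the rest of the clamp sees only the tail.\<close>

lemma evolution_comm_eigenvector_le:
  assumes ev: "eigenvector (schroedinger V) x" and "0 \<le> R" "0 \<le> S" "0 \<le> T"
  shows "norm (evolution_comm V j (clamp_int S) T x) \<le>
    2 * of_int R * norm x + 2 * norm (mult_coord j (indicator {k. R \<le> \<bar>k\<bar>}) x) * T"
    (is "_ \<le> _ + 2 * norm (?P x) * T")
proof (cases "R \<le> S")
  case True
  let ?g = "\<lambda>k. clamp_int S k - clamp_int R k"
  have g: "\<bar>?g k\<bar> \<le> of_int S + of_int R" for k
    using abs_clamp_int_le[OF \<open>0 \<le> R\<close>, of k] abs_clamp_int_le[OF \<open>0 \<le> S\<close>, of k] by linarith
  have ind: "bounded (range (\<lambda>n :: int ^ 'm. complex_of_real (indicator {k. R \<le> \<bar>k\<bar>} (n $ j))))"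
    by (auto simp: bounded_iff indicator_def intro!: exI[of _ 1])
  have diff: "norm (evolution_comm V j ?g T x) \<le> 2 * norm (?P x) * T"
  proof (rule evolution_comm_le[OF g \<open>0 \<le> T\<close> clamp_int_diff_step[OF \<open>0 \<le> R\<close> True]])
    fix t assume "t \<in> {0..T}"
    then obtain c where c: "cmod c \<le> 1" "evolution V t x = c *\<^sub>C x"
      using evolution_eigenvector[OF ev, of t] by auto
    then show "norm (?P (evolution V t x)) \<le> norm (?P x)"
      by (simp add: mult_op_scaleC[OF ind] norm_scaleC mult_left_le_one_le)
  qed
  have "mult_coord j (clamp_int S) y = mult_coord j (clamp_int R) y + mult_coord j ?g y" for y
  proof -
    have D: "y \<in> mult_domain (\<lambda>n :: int ^ 'm. complex_of_real (h (n $ j)))"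
      if "\<And>k. \<bar>h k\<bar> \<le> b" for h b
      using mult_domain_bounded[of "\<lambda>n :: int ^ 'm. complex_of_real (h (n $ j))" b] that by auto
    show ?thesis
      using D[of "clamp_int S", OF abs_clamp_int_le[OF \<open>0 \<le> S\<close>]]
        D[of "clamp_int R", OF abs_clamp_int_le[OF \<open>0 \<le> R\<close>]] D[of ?g, OF g]
      by (intro ell2_eqI) (simp add: plus_ell2.rep_eq apply_mult_op algebra_simps)
  qed
  then have "evolution_comm V j (clamp_int S) T x =
      evolution_comm V j (clamp_int R) T x + evolution_comm V j ?g T x"
    by (simp only: evolution_comm_def evolution_add) simp
  then have "norm (evolution_comm V j (clamp_int S) T x) \<le>
      norm (evolution_comm V j (clamp_int R) T x) + norm (evolution_comm V j ?g T x)"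
    by (simp only: norm_triangle_ineq)
  also have "\<dots> \<le> 2 * of_int R * norm x + 2 * norm (?P x) * T"
    using evolution_comm_clamp_crude[OF \<open>0 \<le> R\<close> \<open>0 \<le> T\<close>] diff by (rule add_mono)
  finally show ?thesis .
next
  case False
  \<comment> \<open>Here \<open>S < R\<close>, and the bound constant in \<open>T\<close> at level
    \<open>S\<close> is already below the first summand.\<close>
  have "norm (evolution_comm V j (clamp_int S) T x) \<le> 2 * of_int S * norm x"
    using \<open>0 \<le> S\<close> \<open>0 \<le> T\<close> by (rule evolution_comm_clamp_crude)
  also have "\<dots> \<le> 2 * of_int R * norm x"
    using False by (intro mult_right_mono) auto
  finally show ?thesis using \<open>0 \<le> T\<close> by (simp add: add_increasing2)
qed

section \<open>The closed subspace of sublinear commutator growth\<close>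

text \<open>The threshold for \<open>T\<close> is chosen before \<open>S\<close>. This uniformity
  lets the estimate survive the removal of the clamp.\<close>

definition sublinear_comm :: "'m \<Rightarrow> (int ^ 'm) ell2 set" where
  "sublinear_comm j = {x. \<forall>e>0. \<forall>\<^sub>F T in at_top. \<forall>S\<ge>0.
     norm (evolution_comm V j (clamp_int S) T x) \<le> e * T}"

lemma eigenvector_sublinear_comm:
  assumes "eigenvector (schroedinger V) x"
  shows "x \<in> sublinear_comm j"
  unfolding sublinear_comm_def
proof (intro CollectI allI impI)
  fix e :: real assume "e > 0"
  \<comment> \<open>A tail of size \<open>e / 4\<close> contributes at most
    \<open>e / 2 * T\<close>. The threshold on \<open>T\<close> below makes the term with
    \<open>R\<close> at most \<open>e / 2 * T\<close> as well.\<close>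
  then have "e / 4 > 0" by simp
  from tail_small[OF this, of j x] obtain R where R: "0 \<le> R"
    "norm (mult_coord j (indicator {k. R \<le> \<bar>k\<bar>}) x) \<le> e / 4" by blast
  show "\<forall>\<^sub>F T in at_top. \<forall>S\<ge>0. norm (evolution_comm V j (clamp_int S) T x) \<le> e * T"
    using eventually_ge_at_top[of "4 * of_int R * norm x / e"] eventually_ge_at_top[of 0]
  proof eventually_elim
    case (elim T)
    have "2 * of_int R * norm x \<le> e / 2 * T"
      using elim(1) \<open>e > 0\<close> by (simp add: field_simps)
    moreover have "2 * norm (mult_coord j (indicator {k. R \<le> \<bar>k\<bar>}) x) * T \<le> e / 2 * T"
      using R(2) elim(2) by (intro mult_right_mono) auto
    ultimately show ?case
      using evolution_comm_eigenvector_le[OF assms R(1) _ elim(2), of _ j] by fastforce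
  qed
qed

lemma subspace_sublinear_comm: "ell2.subspace (sublinear_comm j)"
proof (rule ell2.subspaceI)
  have zero: "evolution_comm V j (clamp_int S) T 0 = 0" if "0 \<le> S" for S T
    using evolution_comm_scaleC[of "clamp_int S" "of_int S" j T 0 0, OF abs_clamp_int_le[OF that]] by simp
  show "0 \<in> sublinear_comm j"
    unfolding sublinear_comm_def
    by (auto simp: zero intro!: eventually_mono[OF eventually_ge_at_top[of 0]])
next
  fix x y assume xy: "x \<in> sublinear_comm j" "y \<in> sublinear_comm j"
  show "x + y \<in> sublinear_comm j"
    unfolding sublinear_comm_def
  proof (intro CollectI allI impI)
    fix e :: real assume "e > 0"
    then have "\<forall>\<^sub>F T in at_top. \<forall>S\<ge>0. norm (evolution_comm V j (clamp_int S) T z) \<le> e / 2 * T"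
      if "z \<in> sublinear_comm j" for z
      using that unfolding sublinear_comm_def by (auto dest!: spec[of _ "e / 2"])
    from this[OF xy(1)] this[OF xy(2)]
    show "\<forall>\<^sub>F T in at_top. \<forall>S\<ge>0. norm (evolution_comm V j (clamp_int S) T (x + y)) \<le> e * T"
    proof eventually_elim
      case (elim T)
      show ?case
      proof (intro allI impI)
        fix S :: int assume S: "0 \<le> S"
        show "norm (evolution_comm V j (clamp_int S) T (x + y)) \<le> e * T"
          unfolding evolution_comm_add[of "clamp_int S", OF abs_clamp_int_le[OF S]]
          using norm_triangle_mono[OF elim(1)[rule_format, OF S] elim(2)[rule_format, OF S]]
          by (simp add: mult.commute)
      qed
    qed
  qed
next
  fix c x assume x: "x \<in> sublinear_comm j"
  show "c *\<^sub>C x \<in> sublinear_comm j"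
    unfolding sublinear_comm_def
  proof (intro CollectI allI impI)
    fix e :: real assume "e > 0"
    \<comment> \<open>The summand 1 keeps the denominator positive when
      \<open>c = 0\<close>.\<close>
    then have pos: "e / (cmod c + 1) > 0" by (simp add: add_nonneg_pos)
    then have "\<forall>\<^sub>F T in at_top. \<forall>S\<ge>0.
        norm (evolution_comm V j (clamp_int S) T x) \<le> e / (cmod c + 1) * T"
      using x unfolding sublinear_comm_def by blast
    then show "\<forall>\<^sub>F T in at_top. \<forall>S\<ge>0. norm (evolution_comm V j (clamp_int S) T (c *\<^sub>C x)) \<le> e * T"
    proof eventually_elim
      case (elim T)
      show ?case
      proof (intro allI impI)
        fix S :: int assume S: "0 \<le> S"
        let ?n = "norm (evolution_comm V j (clamp_int S) T x)"
        have "cmod c * ?n \<le> (cmod c + 1) * ?n" by (simp add: mult_right_mono)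
        also have "\<dots> \<le> (cmod c + 1) * (e / (cmod c + 1) * T)"
          using elim S by (intro mult_left_mono) auto
        also have "\<dots> = e * T"
          using norm_ge_zero[of c] by (simp add: add_nonneg_eq_0_iff)
        finally show "norm (evolution_comm V j (clamp_int S) T (c *\<^sub>C x)) \<le> e * T"
          by (simp add: evolution_comm_scaleC[of "clamp_int S", OF abs_clamp_int_le[OF S]] norm_scaleC)
      qed
    qed
  qed
qed

text \<open>Replacing \<open>x\<close> by a vector \<open>y\<close> within \<open>e / 4\<close>
  costs at most \<open>2 * (e / 4) * T\<close> by the ballistic bound, for all \<open>S\<close> at
  once. The growth of \<open>y\<close> takes the other half of \<open>e * T\<close>.\<close>

lemma closed_sublinear_comm: "closure (sublinear_comm j) \<subseteq> sublinear_comm j"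
proof
  fix x assume x: "x \<in> closure (sublinear_comm j)"
  show "x \<in> sublinear_comm j"
    unfolding sublinear_comm_def
  proof (intro CollectI allI impI)
    fix e :: real assume "e > 0"
    then obtain y where y: "y \<in> sublinear_comm j" "dist y x < e / 4"
      using x by (metis closure_approachable divide_pos_pos zero_less_numeral)
    have "\<forall>\<^sub>F T in at_top. \<forall>S\<ge>0. norm (evolution_comm V j (clamp_int S) T y) \<le> e / 2 * T"
      using y(1) \<open>e > 0\<close> unfolding sublinear_comm_def by (auto dest!: spec[of _ "e / 2"])
    then show "\<forall>\<^sub>F T in at_top. \<forall>S\<ge>0. norm (evolution_comm V j (clamp_int S) T x) \<le> e * T"
      using eventually_ge_at_top[of 0]
    proof eventually_elim
      case (elim T)
      show ?case
      proof (intro allI impI)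
        fix S :: int assume S: "0 \<le> S"
        have "norm (evolution_comm V j (clamp_int S) T (y + (x - y))) \<le>
            norm (evolution_comm V j (clamp_int S) T y) +
            norm (evolution_comm V j (clamp_int S) T (x - y))"
          unfolding evolution_comm_add[of "clamp_int S", OF abs_clamp_int_le[OF S]] by (rule norm_triangle_ineq)
        also have "\<dots> \<le> e / 2 * T + 2 * norm (x - y) * T"
          using elim S evolution_comm_clamp_le[OF S elim(2)] by (intro add_mono) auto
        also have "\<dots> \<le> e / 2 * T + 2 * (e / 4) * T"
          using y(2) elim(2)
          by (intro add_mono mult_right_mono mult_left_mono) (auto simp: dist_norm norm_minus_commute)
        finally show "norm (evolution_comm V j (clamp_int S) T x) \<le> e * T"
          by (simp add: algebra_simps)
      qed
    qed
  qed
qed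

lemma pp_subspace_sublinear_comm: "pp_subspace (schroedinger V) \<subseteq> sublinear_comm j"
proof -
  have "ell2.span {x. eigenvector (schroedinger V) x} \<subseteq> sublinear_comm j"
    using eigenvector_sublinear_comm by (intro ell2.span_minimal subspace_sublinear_comm) auto
  then show ?thesis
    unfolding pp_subspace_def using closure_mono closed_sublinear_comm by blast
qed

section \<open>Removing the clamp\<close>

text \<open>Moving the clamp past the evolution leaves the evolved clamped vector, controlled by the
  position norm of \<open>x\<close>, plus the commutator. The sum is bounded uniformly in
  \<open>S\<close>.\<close>

lemma position_evolution:
  assumes "x \<in> position_domain j"
    and c: "\<And>S. 0 \<le> S \<Longrightarrow> norm (evolution_comm V j (clamp_int S) T x) \<le> c" and "0 \<le> T"
  shows "evolution V T x \<in> position_domain j"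
    and "norm (position j (evolution V T x)) \<le> norm (position j x) + c"
proof -
  have "norm (mult_coord j (clamp_int S) (evolution V T x)) \<le> norm (position j x) + c"
    if S: "0 \<le> S" for S
  proof -
    have "mult_coord j (clamp_int S) (evolution V T x) =
        evolution V T (mult_coord j (clamp_int S) x) + evolution_comm V j (clamp_int S) T x"
      by (simp add: evolution_comm_def)
    then have "norm (mult_coord j (clamp_int S) (evolution V T x)) \<le>
        norm (evolution V T (mult_coord j (clamp_int S) x)) +
        norm (evolution_comm V j (clamp_int S) T x)"
      by (simp only: norm_triangle_ineq)
    also have "\<dots> \<le> norm (position j x) + c"
      using order_trans[OF norm_evolution_le[OF \<open>0 \<le> T\<close>] norm_clamp_le_position[OF assms(1) S]] c[OF S]
      by (rule add_mono)
    finally show ?thesis .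
  qed
  then show "evolution V T x \<in> position_domain j"
    and "norm (position j (evolution V T x)) \<le> norm (position j x) + c"
    using position_of_clamp_bound[of j "evolution V T x"] by blast+
qed

lemma evolution_eq: "exp_op (\<lambda>\<phi>. (- \<i> * of_real T) *\<^sub>C schroedinger V \<phi>) = evolution V T"
  by (simp only: evolution_def generator_def scaleC_scaleR)

text \<open>The outer factor exp(iTH) has the skew generator iH and is a contraction for
  \<open>0 \<le> T\<close>.\<close>

lemma norm_heisenberg_le:
  assumes "0 \<le> T"
  shows "norm (heisenberg (schroedinger V) T B x) \<le> norm (B (evolution V T x))"
  unfolding heisenberg_def evolution_eq
  unfolding scaleC_scaleR
  using assms by (intro norm_exp_op_skew_le bounded_linear_scaleC bounded_linear_schroedinger
      skew_schroedinger V) auto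

end

theorem theorem4p4:
  fixes V :: "int ^ 'm \<Rightarrow> real" and \<psi> :: "(int ^ 'm) ell2"
  assumes "bounded (range V)"
    and "\<psi> \<in> pp_subspace (schroedinger V)"
    and "\<psi> \<in> (\<Inter>j. position_domain j)"
  shows "(\<forall>T>0. \<forall>j. \<psi> \<in> heisenberg_domain (schroedinger V) T (position_domain j)) \<and>
         (\<forall>j. ((\<lambda>T. (1 / T) *\<^sub>R heisenberg (schroedinger V) T (position j) \<psi>) \<longlongrightarrow> 0) at_top)"
proof (intro conjI allI impI)
  fix T :: real and j assume "T > 0"
  \<comment> \<open>At a fixed time the ballistic bound is a finite constant uniform in
    \<open>S\<close>, which gives the domain statement.\<close>
  then have "evolution V T \<psi> \<in> position_domain j"
    using assms(3) evolution_comm_clamp_le[OF assms(1)]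
    by (intro position_evolution(1)[OF assms(1), where c = "2 * norm \<psi> * T"]) auto
  then show "\<psi> \<in> heisenberg_domain (schroedinger V) T (position_domain j)"
    by (simp only: heisenberg_domain_def evolution_eq[OF assms(1)] mem_Collect_eq)
next
  fix j
  have dom: "\<psi> \<in> position_domain j" using assms(3) by blast
  have sub: "\<psi> \<in> sublinear_comm V j"
    using pp_subspace_sublinear_comm[OF assms(1)] assms(2) by blast
  show "((\<lambda>T. (1 / T) *\<^sub>R heisenberg (schroedinger V) T (position j) \<psi>) \<longlongrightarrow> 0) at_top"
  proof (rule tendstoI)
    fix e :: real assume "e > 0"
    \<comment> \<open>One half of \<open>e * T\<close> goes to the commutator. The threshold on
      \<open>T\<close> below makes the constant \<open>norm (position j \<psi>)\<close> smaller than
      the other half.\<close>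
    then have "\<forall>\<^sub>F T in at_top. \<forall>S\<ge>0. norm (evolution_comm V j (clamp_int S) T \<psi>) \<le> e / 2 * T"
      using sub unfolding sublinear_comm_def[OF assms(1)] by (auto dest!: spec[of _ "e / 2"])
    then show "\<forall>\<^sub>F T in at_top. dist ((1 / T) *\<^sub>R heisenberg (schroedinger V) T (position j) \<psi>) 0 < e"
      using eventually_gt_at_top[of "2 * norm (position j \<psi>) / e"] eventually_gt_at_top[of 0]
    proof eventually_elim
      case (elim T)
      have "norm (heisenberg (schroedinger V) T (position j) \<psi>) \<le>
          norm (position j (evolution V T \<psi>))"
        using elim by (intro norm_heisenberg_le[OF assms(1)]) auto
      also have "\<dots> \<le> norm (position j \<psi>) + e / 2 * T"
        using elim by (intro position_evolution(2)[OF assms(1) dom]) auto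
      also have "\<dots> < e * T"
        using elim \<open>e > 0\<close> by (simp add: field_simps)
      finally show ?case
        using elim by (simp add: divide_simps mult.commute)
    qed
  qed
qed

end
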